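(* Let $G=(V,E)$ be a graph on $n$ vertices and $k\ge 0$ an integer with $n>k+1$, such that none of Rules (R1), (R2), (R3) below applies to $(G,k)$. Let $S$ be a minimum-size set of pairs of vertices such that $H=(V,E\triangle S)$ is a cograph, with $|S|\le k$. Let $T$ be the canonical cotree of $H$, $T'$ the subtree of $T$ induced by the nodes $u$ with $|De(u)|\ge k+2$, and $T''$ the forest obtained from $T'$ by removing the edges that belong to no edit path. If $T''$ contains a $51$-sparse path with respect to the edit paths, then there is an integer $t\ge 1$ and a nested $t$-module $(A,B,C,K,I)$ of $G$ (with respect to $k$) such that $G$ has an edge between $A$ and $I$ or a non-edge between $A$ and $K$ (so the nested $t$-module rule applies to $G$). Moreover, such a nested $t$-module can be found in time polynomial in $n$.
   Context: A cograph is a graph with no induced $P_4$. The canonical cotree of a cograph $H$ is a rooted tree whose leaves are the vertices of $H$, whose internal nodes have at least two children and labels $+$ or $\oplus$ alternating along every root-leaf path, such that two vertices are adjacent in $H$ iff their least common ancestor is labelled $\oplus$. $De(u)$ is the set of leaves descending from node $u$. For each pair $xy\in S$ with least common ancestor $z$ in $T$, the descending paths from $z$ to $x$ and from $z$ to $y$ are edit paths. A descending path is a path from a node to one of its descendants. A path $Q$ of $T''$ is $51$-sparse with respect to the edit paths if $Q$ is a descending path that is a subpath of some edit path, has at least one edge, and at most $|E(Q)|/51$ edit paths share at least one edge with $Q$. A module is a set of vertices all having the same neighborhood outside it; a comodule is a module which is the vertex set of a connected component of $G$ or of its complement; a $t$-module is a vertex set that becomes a module after editing (toggling adjacency of) at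 most $t$ pairs. Rules: (R1) if $G$ has a comodule $C$ inducing a cograph, remove $C$; (R2) if $G$ has a module $M$ with $|M|>k+1$ inducing an independent set, delete vertices of $M$ until it has size $k+1$; (R3) if $X$ is a module which is not a comodule and $G[X]$ contains an edge, add a disjoint copy of $G[X]$ and replace the original $G[X]$ by an independent set on $X$. A nested $t$-module of $G$ with respect to $k$ is a partition of $V$ into five nonempty sets $A,B,C,K,I$ such that $A$, $A\cup B$, $A\cup B\cup C$ are $t$-modules, $|A|>k+t$, and each of the following sets has at least $3t+1$ elements: $B_\oplus$ (vertices of $B$ adjacent to all of $A\cup K$ and to none of $I$), $B_+$ (vertices of $B$ adjacent to all of $K$ and to none of $A\cup I$), $C_\oplus$ (vertices of $C$ adjacent to all of $A\cup B\cup K$ and to none of $I$), $C_+$ (vertices of $C$ adjacent to all of $K$ and to none of $A\cup B\cup I$). The nested $t$-module rule edits every edge between $A$ and $I$ and every non-edge between $A$ and $K$. *)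

theory Defs
  imports
    "HOL-Computational_Algebra.Polynomial"
    "HOL-Library.Sublist"
begin

section \<open>Graphs, cographs and modules\<close>

definition all_pairs :: "'a set \<Rightarrow> 'a set set" where
  "all_pairs V = {e. \<exists>x\<in>V. \<exists>y\<in>V. x \<noteq> y \<and> e = {x, y}}"

definition simple_graph :: "'a set \<Rightarrow> 'a set set \<Rightarrow> bool" where
  "simple_graph V E \<longleftrightarrow> finite V \<and> E \<subseteq> all_pairs V"

definition induced_edges :: "'a set set \<Rightarrow> 'a set \<Rightarrow> 'a set set" where
  "induced_edges E X = {e \<in> E. e \<subseteq> X}"

definition is_cograph :: "'a set \<Rightarrow> 'a set set \<Rightarrow> bool" where
  "is_cograph V E \<longleftrightarrow>
     \<not> (\<exists>a\<in>V. \<exists>b\<in>V. \<exists>c\<in>V. \<exists>d\<in>V. distinct [a, b, c, d] \<and>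
          {a, b} \<in> E \<and> {b, c} \<in> E \<and> {c, d} \<in> E \<and>
          {a, c} \<notin> E \<and> {a, d} \<notin> E \<and> {b, d} \<notin> E)"

definition is_module :: "'a set \<Rightarrow> 'a set set \<Rightarrow> 'a set \<Rightarrow> bool" where
  "is_module V E M \<longleftrightarrow> M \<subseteq> V \<and>
     (\<forall>x\<in>M. \<forall>y\<in>M. {u \<in> V - M. {x, u} \<in> E} = {u \<in> V - M. {y, u} \<in> E})"

definition is_component :: "'a set \<Rightarrow> 'a set set \<Rightarrow> 'a set \<Rightarrow> bool" where
  "is_component V E C \<longleftrightarrow>
     (\<exists>x\<in>V. C = {y \<in> V. (x, y) \<in> {(a, b). {a, b} \<in> E}\<^sup>*})"

definition is_comodule :: "'a set \<Rightarrow> 'a set set \<Rightarrow> 'a set \<Rightarrow> bool" where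
  "is_comodule V E C \<longleftrightarrow> is_module V E C \<and>
     (is_component V E C \<or> is_component V (all_pairs V - E) C)"

definition is_t_module :: "'a set \<Rightarrow> 'a set set \<Rightarrow> nat \<Rightarrow> 'a set \<Rightarrow> bool" where
  "is_t_module V E t X \<longleftrightarrow>
     (\<exists>F. F \<subseteq> all_pairs V \<and> card F \<le> t \<and> is_module V (sym_diff E F) X)"

definition R1_applies :: "'a set \<Rightarrow> 'a set set \<Rightarrow> bool" where
  "R1_applies V E \<longleftrightarrow> (\<exists>C. is_comodule V E C \<and> is_cograph C (induced_edges E C))"

definition R2_applies :: "'a set \<Rightarrow> 'a set set \<Rightarrow> nat \<Rightarrow> bool" where
  "R2_applies V E k \<longleftrightarrow>
     (\<exists>M. is_module V E M \<and> card M > k + 1 \<and> induced_edges E M = {})"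

definition R3_applies :: "'a set \<Rightarrow> 'a set set \<Rightarrow> bool" where
  "R3_applies V E \<longleftrightarrow>
     (\<exists>X. is_module V E X \<and> \<not> is_comodule V E X \<and> induced_edges E X \<noteq> {})"

definition is_cograph_editing :: "'a set \<Rightarrow> 'a set set \<Rightarrow> 'a set set \<Rightarrow> bool" where
  "is_cograph_editing V E S \<longleftrightarrow> S \<subseteq> all_pairs V \<and> is_cograph V (sym_diff E S)"

definition is_min_cograph_editing :: "'a set \<Rightarrow> 'a set set \<Rightarrow> 'a set set \<Rightarrow> bool" where
  "is_min_cograph_editing V E S \<longleftrightarrow> is_cograph_editing V E S \<and>
     (\<forall>S'. is_cograph_editing V E S' \<longrightarrow> card S \<le> card S')"


section \<open>Canonical cotrees\<close>

datatype node_label = Plus | OPlus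

text \<open>
  The set function \<open>leaves\<close> of the datatype gives the set of leaves descending from a node.
  In a cotree the leaves are pairwise different and internal nodes have at least two children,
  so distinct nodes carry distinct subtrees. A node is therefore identified with the
  subtree rooted at it; the order of the list of children is irrelevant.
\<close>

datatype (leaves: 'a) cotree = Leaf 'a | Node node_label "'a cotree list"

primrec children :: "'a cotree \<Rightarrow> 'a cotree list" where
  "children (Leaf v) = []"
| "children (Node l ts) = ts"

primrec nodes :: "'a cotree \<Rightarrow> 'a cotree set" where
  "nodes (Leaf v) = {Leaf v}"
| "nodes (Node l ts) = insert (Node l ts) (\<Union>(set (map nodes ts)))"

definition is_lca :: "'a cotree \<Rightarrow> 'a \<Rightarrow> 'a \<Rightarrow> 'a cotree \<Rightarrow> bool" where
  "is_lca T x y z \<longleftrightarrow> z \<in> nodes T \<and> {x, y} \<subseteq> leaves z \<and>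
     (\<forall>w\<in>nodes T. {x, y} \<subseteq> leaves w \<longrightarrow> z \<in> nodes w)"

definition is_canonical_cotree :: "'a cotree \<Rightarrow> 'a set \<Rightarrow> 'a set set \<Rightarrow> bool" where
  "is_canonical_cotree T V E \<longleftrightarrow>
     leaves T = V \<and>
     (\<forall>l ts. Node l ts \<in> nodes T \<longrightarrow>
        length ts \<ge> 2 \<and>
        (\<forall>i<length ts. \<forall>j<length ts. i \<noteq> j \<longrightarrow> leaves (ts ! i) \<inter> leaves (ts ! j) = {}) \<and>
        (\<forall>l' us. Node l' us \<in> set ts \<longrightarrow> l' \<noteq> l)) \<and>
     (\<forall>x\<in>V. \<forall>y\<in>V. x \<noteq> y \<longrightarrow>
        ({x, y} \<in> E \<longleftrightarrow> (\<exists>ts. is_lca T x y (Node OPlus ts))))"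


section \<open>Edit paths and sparse paths\<close>

definition descending_path :: "'a cotree \<Rightarrow> 'a cotree list \<Rightarrow> bool" where
  "descending_path T P \<longleftrightarrow> P \<noteq> [] \<and> set P \<subseteq> nodes T \<and>
     successively (\<lambda>u w. w \<in> set (children u)) P"

definition path_edges :: "'a cotree list \<Rightarrow> ('a cotree \<times> 'a cotree) set" where
  "path_edges P = set (zip P (tl P))"

text \<open>
  An edited pair \<open>{x, y}\<close> with least common ancestor \<open>z\<close> yields two edit paths, from \<open>z\<close> to \<open>x\<close>
  and from \<open>z\<close> to \<open>y\<close>. The edit paths form a family indexed by the ordered pairs \<open>(x, y)\<close> with
  \<open>{x, y} \<in> S\<close>, the path with index \<open>(x, y)\<close> being the one that ends in \<open>x\<close>. Paths that belong to
  different edited pairs are counted separately, also if they coincide as paths of the tree.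
\<close>

definition edit_path :: "'a cotree \<Rightarrow> 'a set set \<Rightarrow> 'a \<times> 'a \<Rightarrow> 'a cotree list \<Rightarrow> bool" where
  "edit_path T S = (\<lambda>(x, y) P. {x, y} \<in> S \<and> descending_path T P \<and>
     is_lca T x y (hd P) \<and> last P = Leaf x)"

definition T'_nodes :: "'a cotree \<Rightarrow> nat \<Rightarrow> 'a cotree set" where
  "T'_nodes T k = {u \<in> nodes T. card (leaves u) \<ge> k + 2}"

text \<open>The nodes of \<open>T''\<close> are those of \<open>T'\<close>; edges are directed from parent to child.\<close>

definition T''_edges :: "'a cotree \<Rightarrow> 'a set set \<Rightarrow> nat \<Rightarrow> ('a cotree \<times> 'a cotree) set" where
  "T''_edges T S k = {(u, w). u \<in> T'_nodes T k \<and> w \<in> T'_nodes T k \<and> w \<in> set (children u) \<and>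
     (\<exists>q P. edit_path T S q P \<and> (u, w) \<in> path_edges P)}"

definition is_sparse_path ::
  "nat \<Rightarrow> 'a cotree \<Rightarrow> 'a set set \<Rightarrow> nat \<Rightarrow> 'a cotree list \<Rightarrow> bool" where
  "is_sparse_path c T S k Q \<longleftrightarrow>
     descending_path T Q \<and> set Q \<subseteq> T'_nodes T k \<and> path_edges Q \<subseteq> T''_edges T S k \<and>
     (\<exists>q P. edit_path T S q P \<and> sublist Q P) \<and>
     path_edges Q \<noteq> {} \<and>
     real (card {q. \<exists>P. edit_path T S q P \<and> path_edges P \<inter> path_edges Q \<noteq> {}})
       \<le> real (card (path_edges Q)) / real c"


section \<open>Nested modules\<close>

text \<open>
  \<open>attached E X Y Z\<close> is the set of vertices of \<open>X\<close> adjacent to all of \<open>Y\<close> and to none of \<open>Z\<close>.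
\<close>

definition attached :: "'a set set \<Rightarrow> 'a set \<Rightarrow> 'a set \<Rightarrow> 'a set \<Rightarrow> 'a set" where
  "attached E X Y Z = {x \<in> X. (\<forall>y\<in>Y. {x, y} \<in> E) \<and> (\<forall>z\<in>Z. {x, z} \<notin> E)}"

definition is_nested_t_module ::
  "'a set \<Rightarrow> 'a set set \<Rightarrow> nat \<Rightarrow> nat \<Rightarrow>
   'a set \<Rightarrow> 'a set \<Rightarrow> 'a set \<Rightarrow> 'a set \<Rightarrow> 'a set \<Rightarrow> bool" where
  "is_nested_t_module V E k t A B C K I \<longleftrightarrow>
     A \<union> B \<union> C \<union> K \<union> I = V \<and>
     A \<noteq> {} \<and> B \<noteq> {} \<and> C \<noteq> {} \<and> K \<noteq> {} \<and> I \<noteq> {} \<and>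
     A \<inter> B = {} \<and> A \<inter> C = {} \<and> A \<inter> K = {} \<and> A \<inter> I = {} \<and> B \<inter> C = {} \<and>
     B \<inter> K = {} \<and> B \<inter> I = {} \<and> C \<inter> K = {} \<and> C \<inter> I = {} \<and> K \<inter> I = {} \<and>
     is_t_module V E t A \<and> is_t_module V E t (A \<union> B) \<and> is_t_module V E t (A \<union> B \<union> C) \<and>
     card A > k + t \<and>
     card (attached E B (A \<union> K) I) \<ge> 3 * t + 1 \<and>
     card (attached E B K (A \<union> I)) \<ge> 3 * t + 1 \<and>
     card (attached E C (A \<union> B \<union> K) I) \<ge> 3 * t + 1 \<and>
     card (attached E C K (A \<union> B \<union> I)) \<ge> 3 * t + 1"

definition nested_rule_applies ::
  "'a set set \<Rightarrow> 'a set \<Rightarrow> 'a set \<Rightarrow> 'a set \<Rightarrow> bool" where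
  "nested_rule_applies E A K I \<longleftrightarrow>
     (\<exists>a\<in>A. \<exists>i\<in>I. {a, i} \<in> E) \<or> (\<exists>a\<in>A. \<exists>c\<in>K. {a, c} \<notin> E)"


section \<open>Random access machine programs\<close>

text \<open>
  Structured programs of a random access machine whose memory cells hold natural numbers.
  Assignments and tests cost one step. The only arithmetic operations are addition and truncated
  subtraction, and the expressions of a fixed program have bounded size, so a single step increases
  the bit length of the largest number in memory by at most a constant. Polynomially many steps
  are hence the same as polynomial time on a Turing machine.
\<close>

datatype aexp = Const nat | Mem aexp | Add aexp aexp | Sub aexp aexp

datatype com = Assign aexp aexp | Seq com com | If aexp com com | While aexp com

type_synonym memory = "nat \<Rightarrow> nat"

primrec aval :: "aexp \<Rightarrow> memory \<Rightarrow> nat" where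
  "aval (Const n) s = n"
| "aval (Mem a) s = s (aval a s)"
| "aval (Add a b) s = aval a s + aval b s"
| "aval (Sub a b) s = aval a s - aval b s"

text \<open>
  \<open>exec c s m s'\<close>: program \<open>c\<close> started in memory \<open>s\<close> halts after \<open>m\<close> steps in memory \<open>s'\<close>.
  \<open>Assign a b\<close> stores the value of \<open>b\<close> in the cell whose address is the value of \<open>a\<close>; a test
  succeeds iff the value is not zero.
\<close>

inductive exec :: "com \<Rightarrow> memory \<Rightarrow> nat \<Rightarrow> memory \<Rightarrow> bool" where
  Assign: "exec (Assign a b) s 1 (s(aval a s := aval b s))"
| Seq: "exec c1 s m1 s1 \<Longrightarrow> exec c2 s1 m2 s2 \<Longrightarrow> exec (Seq c1 c2) s (m1 + m2) s2"
| IfTrue: "aval a s \<noteq> 0 \<Longrightarrow> exec c1 s m s1 \<Longrightarrow> exec (If a c1 c2) s (1 + m) s1"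
| IfFalse: "aval a s = 0 \<Longrightarrow> exec c2 s m s1 \<Longrightarrow> exec (If a c1 c2) s (1 + m) s1"
| WhileFalse: "aval a s = 0 \<Longrightarrow> exec (While a c) s 1 s"
| WhileTrue: "aval a s \<noteq> 0 \<Longrightarrow> exec c s m1 s1 \<Longrightarrow> exec (While a c) s1 m2 s2 \<Longrightarrow>
    exec (While a c) s (1 + m1 + m2) s2"

text \<open>
  Input for a graph with vertex list \<open>vs\<close> of length \<open>n\<close>: cell \<open>0\<close> holds \<open>n\<close>, cell \<open>1\<close> holds the
  parameter \<open>k\<close>, the next \<open>n * n\<close> cells hold the adjacency matrix row by row, and all other cells
  are \<open>0\<close>.
\<close>

definition graph_input :: "'a list \<Rightarrow> 'a set set \<Rightarrow> nat \<Rightarrow> memory" where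
  "graph_input vs E k = (\<lambda>a. let n = length vs in
     if a = 0 then n else if a = 1 then k
     else if a < 2 + n * n \<and> {vs ! ((a - 2) div n), vs ! ((a - 2) mod n)} \<in> E then 1
     else 0)"

text \<open>
  Output: cell \<open>0\<close> holds \<open>t\<close>, and cell \<open>1 + i\<close> holds the number of the part that contains the
  vertex \<open>vs ! i\<close>. The parts \<open>A\<close>, \<open>B\<close>, \<open>C\<close>, \<open>K\<close>, \<open>I\<close> have the numbers 0, 1, 2, 3, 4.
\<close>

definition output_part :: "'a list \<Rightarrow> memory \<Rightarrow> nat \<Rightarrow> 'a set" where
  "output_part vs s j = {vs ! i | i. i < length vs \<and> s (1 + i) = j}"

end

theory Submission
  imports Defs
begin

text \<open>
  Let \<open>t\<close> be the number of edit paths that share an edge with the sparse path \<open>Q\<close>, whose nodes from the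
  top are \<open>u\<^sub>0, \<dots>, u\<^sub>m\<close>, so that \<open>51 * t \<le> m\<close>. Every edited pair between \<open>De(u\<^sub>i)\<close> and the rest
  (\<open>i \<ge> 1\<close>) has an edit path through the edge above \<open>u\<^sub>i\<close>, hence there are at most \<open>t\<close> such pairs, each
  \<open>De(u\<^sub>i)\<close> is a \<open>t\<close>-module of \<open>G\<close>, and at most \<open>2 * t\<close> vertices are dirty, that is, lie on such a pair.
  Take \<open>A\<close>, \<open>A \<union> B\<close> and \<open>A \<union> B \<union> C\<close> of the form \<open>De(u\<^sub>i)\<close> with sufficiently many levels in
  between: representatives of clean levels supply the attached vertices of \<open>B\<close> and \<open>C\<close>, and the edited
  pair whose edit path contains \<open>Q\<close> makes the rule apply.

  For the algorithm, the three indices are chosen next to five consecutive levels with clean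
  representatives. These five vertices determine \<open>De(u\<^sub>i)\<close> by a boolean combination of their
  neighbourhoods in \<open>G\<close>, so it suffices to try all choices of \<open>t\<close> and of \<open>15\<close> vertices. The check of a
  choice is written as an arithmetic expression with bounded loops, and such expressions are
  compiled to machine programs of polynomial running time.
\<close>

section \<open>Compiling bounded loops\<close>

text \<open>The algorithm sees only \<open>G\<close> and \<open>k\<close>, neither \<open>S\<close>
  nor the cotree nor the sparse path. The predicate \<open>valid\<close> therefore speaks of
  \<open>G\<close> and guessed vertices alone: every guess that passes it yields a nested module,
  and the sparse path serves to show that some guess passes. Clean representatives make this
  possible, since their adjacencies to other levels are the same in \<open>G\<close> and
  \<open>H\<close>. Within one level nothing is known, so a vertex is located by representatives of
  later levels; this is why one clean level is not enough.

  The length of \<open>Q\<close> pays for \<open>6 * t + 1\<close> blocks of six levels, so many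
  that after the loss of \<open>2 * t\<close> dirty blocks three clean ones remain at distance
  \<open>12 * t\<close>, which in turn is room for the \<open>3 * t + 1\<close> attached vertices of
  either label. With \<open>t\<close> further levels for \<open>card A > k + t\<close> this takes at
  most \<open>37 * t + 7\<close> levels, and \<open>51 * t\<close> covers them.

  Expressions cannot store a guess that was found. Each output cell repeats the search; it is
  deterministic, so all cells speak of the same guess.\<close>

definition runs :: "com \<Rightarrow> memory \<Rightarrow> nat \<Rightarrow> (memory \<Rightarrow> bool) \<Rightarrow> bool" where
  "runs c s b Q \<longleftrightarrow> (\<exists>m s'. exec c s m s' \<and> m \<le> b \<and> Q s')"

lemma runs_weaken: "runs c s b Q \<Longrightarrow> b \<le> b' \<Longrightarrow> (\<And>s'. Q s' \<Longrightarrow> Q' s') \<Longrightarrow> runs c s b' Q'"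
  unfolding runs_def by (meson le_trans)

lemma runs_Assign: "Q (s(aval a s := aval e s)) \<Longrightarrow> runs (Assign a e) s 1 Q"
  unfolding runs_def using exec.Assign by blast

lemma runs_Seq:
  assumes "runs c1 s b1 P" "\<And>s'. P s' \<Longrightarrow> runs c2 s' b2 Q"
  shows "runs (Seq c1 c2) s (b1 + b2) Q"
proof -
  obtain m1 s1 where 1: "exec c1 s m1 s1" "m1 \<le> b1" "P s1"
    using assms(1) unfolding runs_def by blast
  obtain m2 s2 where 2: "exec c2 s1 m2 s2" "m2 \<le> b2" "Q s2"
    using assms(2)[OF 1(3)] unfolding runs_def by blast
  show ?thesis
    unfolding runs_def using exec.Seq[OF 1(1) 2(1)] 1 2 add_mono by blast
qed

lemma runs_Assign_Seq:
  "runs c (s(aval a s := aval e s)) b Q \<Longrightarrow> runs (Seq (Assign a e) c) s (1 + b) Q"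
  by (rule runs_Seq[OF runs_Assign]) auto

lemma runs_If:
  assumes "aval a s \<noteq> 0 \<Longrightarrow> runs c1 s b Q" "aval a s = 0 \<Longrightarrow> runs c2 s b Q"
  shows "runs (If a c1 c2) s (1 + b) Q"
proof (cases "aval a s = 0")
  case True
  then show ?thesis
    using assms(2) exec.IfFalse[of a s] unfolding runs_def by (metis add_left_mono)
next
  case False
  then show ?thesis
    using assms(1) exec.IfTrue[of a s] unfolding runs_def by (metis add_left_mono)
qed

text \<open>The invariant is indexed by the number of finished rounds and forces the loop to stop
  after round \<open>N\<close>. This yields termination and the step bound together; the leading
  \<open>1\<close> of the bound is the failing test.\<close>

lemma runs_While:
  assumes "J i s" "i \<le> N"
    and body: "\<And>i s. i < N \<Longrightarrow> J i s \<Longrightarrow> aval a s \<noteq> 0 \<and> runs c s b (J (Suc i))"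
    and stop: "\<And>s. J N s \<Longrightarrow> aval a s = 0"
  shows "runs (While a c) s (1 + (N - i) * (1 + b)) (J N)"
  using assms(1,2)
proof (induction "N - i" arbitrary: i s)
  case 0
  then have "J N s" by simp
  then show ?case
    using stop[of s] exec.WhileFalse[of a s c] "0.hyps" unfolding runs_def by force
next
  case (Suc x)
  then have i: "i < N" by linarith
  obtain m1 s1 where 1: "exec c s m1 s1" "m1 \<le> b" "J (Suc i) s1"
    using body[OF i Suc.prems(1)] unfolding runs_def by blast
  have x: "x = N - Suc i" using Suc.hyps(2) by linarith
  obtain m2 s2 where 2: "exec (While a c) s1 m2 s2" "m2 \<le> 1 + x * (1 + b)" "J N s2"
    using Suc.hyps(1)[OF x 1(3)] i unfolding runs_def x by auto
  have "exec (While a c) s (1 + m1 + m2) s2"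
    using exec.WhileTrue[OF _ 1(1) 2(1)] body[OF i Suc.prems(1)] by blast
  moreover have "1 + m1 + m2 \<le> 1 + (N - i) * (1 + b)"
    using 1(2) 2(2) unfolding Suc.hyps(2)[symmetric] by simp
  ultimately show ?case
    using 2(3) unfolding runs_def by blast
qed

text \<open>
  Arithmetic expressions over the vertex numbers of the input graph. \<open>Loop False v e\<close> is the sum of
  \<open>e\<close> over all values of \<open>v\<close>, and \<open>Loop True v e\<close> is the first nonzero value of \<open>e\<close>. Every loop runs over
  the vertices, so each fixed expression is evaluated in polynomial time.
\<close>

datatype expr = Num nat | Param | Var nat | Adj nat nat | Add_expr expr expr | Sub_expr expr expr
  | Cond expr expr expr | Loop bool nat expr

primrec accum :: "bool \<Rightarrow> (nat \<Rightarrow> nat) \<Rightarrow> nat \<Rightarrow> nat" where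
  "accum b f 0 = 0"
| "accum b f (Suc i) = (if b \<and> accum b f i \<noteq> 0 then accum b f i else accum b f i + f i)"

primrec eval :: "nat \<Rightarrow> nat \<Rightarrow> (nat \<Rightarrow> nat \<Rightarrow> bool) \<Rightarrow> expr \<Rightarrow> (nat \<Rightarrow> nat) \<Rightarrow> nat" where
  "eval n k r (Num c) \<rho> = c"
| "eval n k r Param \<rho> = k"
| "eval n k r (Var v) \<rho> = \<rho> v"
| "eval n k r (Adj u v) \<rho> = of_bool (r (\<rho> u) (\<rho> v))"
| "eval n k r (Add_expr a b) \<rho> = eval n k r a \<rho> + eval n k r b \<rho>"
| "eval n k r (Sub_expr a b) \<rho> = eval n k r a \<rho> - eval n k r b \<rho>"
| "eval n k r (Cond c a b) \<rho> = (if eval n k r c \<rho> \<noteq> 0 then eval n k r a \<rho> else eval n k r b \<rho>)"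
| "eval n k r (Loop b v e) \<rho> = accum b (\<lambda>i. eval n k r e (\<rho>(v := i))) n"

text \<open>
  Working memory begins behind the adjacency matrix; its first address \<open>n * n + 2\<close> is kept in cell \<open>2\<close>,
  a diagonal entry of the matrix that carries no information. As there is no multiplication, each
  variable \<open>v\<close> comes with a cell \<open>row v\<close> that holds \<open>n\<close> times its value.
\<close>

abbreviation cell :: "nat \<Rightarrow> aexp" where
  "cell c \<equiv> Add (Mem (Const 2)) (Const c)"

definition var :: "nat \<Rightarrow> aexp" where
  "var v = cell (3 * v)"

definition row :: "nat \<Rightarrow> aexp" where
  "row v = cell (3 * v + 1)"

definition tmp :: "nat \<Rightarrow> aexp" where
  "tmp v = cell (3 * v + 2)"

abbreviation vertices :: aexp where
  "vertices \<equiv> Mem (Const 0)"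

definition step :: "nat \<Rightarrow> com" where
  "step v = Seq (Assign (var v) (Add (Mem (var v)) (Const 1)))
    (Assign (row v) (Add (Mem (row v)) vertices))"

text \<open>Temporaries form a stack: code for depth \<open>d\<close> leaves its value in
  \<open>tmp d\<close> and in the end has changed only temporaries from \<open>d\<close> upwards. A
  loop saves its variable and row in \<open>tmp (d + 1)\<close> and \<open>tmp (d + 2)\<close> and
  restores them, so it leaves no trace in the environment. Assigning \<open>tmp d\<close> to itself
  is a skip.\<close>

primrec compile :: "nat \<Rightarrow> expr \<Rightarrow> com" where
  "compile d (Num c) = Assign (tmp d) (Const c)"
| "compile d Param = Assign (tmp d) (Mem (Const 1))"
| "compile d (Var v) = Assign (tmp d) (Mem (var v))"
| "compile d (Adj u v) =
    If (Sub (Mem (var u)) (Mem (var v)))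
      (Assign (tmp d) (Mem (Add (Const 2) (Add (Mem (row u)) (Mem (var v))))))
      (If (Sub (Mem (var v)) (Mem (var u)))
        (Assign (tmp d) (Mem (Add (Const 2) (Add (Mem (row v)) (Mem (var u))))))
        (Assign (tmp d) (Const 0)))"
| "compile d (Add_expr a b) = Seq (compile d a) (Seq (compile (Suc d) b)
    (Assign (tmp d) (Add (Mem (tmp d)) (Mem (tmp (Suc d))))))"
| "compile d (Sub_expr a b) = Seq (compile d a) (Seq (compile (Suc d) b)
    (Assign (tmp d) (Sub (Mem (tmp d)) (Mem (tmp (Suc d))))))"
| "compile d (Cond c a b) = Seq (compile d c) (If (Mem (tmp d)) (compile d a) (compile d b))"
| "compile d (Loop b v e) =
    Seq (Assign (tmp (d + 1)) (Mem (var v)))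
    (Seq (Assign (tmp (d + 2)) (Mem (row v)))
    (Seq (Assign (tmp d) (Const 0))
    (Seq (Assign (var v) (Const 0))
    (Seq (Assign (row v) (Const 0))
    (Seq (While (Sub vertices (Mem (var v)))
      (Seq (compile (d + 3) e)
      (Seq (If (if b then Mem (tmp d) else Const 0)
        (Assign (tmp d) (Mem (tmp d)))
        (Assign (tmp d) (Add (Mem (tmp d)) (Mem (tmp (d + 3))))))
      (step v))))
    (Seq (Assign (var v) (Mem (tmp (d + 1))))
      (Assign (row v) (Mem (tmp (d + 2))))))))))"

text \<open>Both branches of \<open>Cond\<close> are charged, since a maximum of polynomials need
  not be a polynomial. In \<open>Loop\<close>, the \<open>8\<close> counts five initial assignments,
  the failing test and two restoring assignments; the \<open>5\<close> per round counts the test,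
  the update of the accumulator and \<open>step\<close>.\<close>

primrec cost :: "expr \<Rightarrow> nat poly" where
  "cost (Num c) = [:1:]"
| "cost Param = [:1:]"
| "cost (Var v) = [:1:]"
| "cost (Adj u v) = [:3:]"
| "cost (Add_expr a b) = cost a + cost b + [:1:]"
| "cost (Sub_expr a b) = cost a + cost b + [:1:]"
| "cost (Cond c a b) = cost c + cost a + cost b + [:1:]"
| "cost (Loop b v e) = [:8:] + [:0, 1:] * (cost e + [:5:])"

section \<open>Memory layout and frame conditions\<close>

definition var_cell :: "nat \<Rightarrow> nat \<Rightarrow> nat" where
  "var_cell n v = n * n + 2 + 3 * v"

definition row_cell :: "nat \<Rightarrow> nat \<Rightarrow> nat" where
  "row_cell n v = n * n + 2 + (3 * v + 1)"

definition tmp_cell :: "nat \<Rightarrow> nat \<Rightarrow> nat" where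
  "tmp_cell n d = n * n + 2 + (3 * d + 2)"

lemma cell_eq_iff [simp]:
  "var_cell n u = var_cell n v \<longleftrightarrow> u = v"
  "row_cell n u = row_cell n v \<longleftrightarrow> u = v"
  "tmp_cell n u = tmp_cell n v \<longleftrightarrow> u = v"
  "var_cell n u \<noteq> row_cell n v" "row_cell n v \<noteq> var_cell n u"
  "var_cell n u \<noteq> tmp_cell n v" "tmp_cell n v \<noteq> var_cell n u"
  "row_cell n u \<noteq> tmp_cell n v" "tmp_cell n v \<noteq> row_cell n u"
  unfolding var_cell_def row_cell_def tmp_cell_def by presburger+

lemma cell_gt: "x < n * n + 2 \<Longrightarrow> x < var_cell n v \<and> x < row_cell n v \<and> x < tmp_cell n v"
  unfolding var_cell_def row_cell_def tmp_cell_def by simp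

lemma cell_neq [simp]:
  "var_cell n v \<noteq> 0" "row_cell n v \<noteq> 0" "tmp_cell n v \<noteq> 0"
  "0 \<noteq> var_cell n v" "0 \<noteq> row_cell n v" "0 \<noteq> tmp_cell n v"
  "var_cell n v \<noteq> Suc 0" "row_cell n v \<noteq> Suc 0" "tmp_cell n v \<noteq> Suc 0"
  "Suc 0 \<noteq> var_cell n v" "Suc 0 \<noteq> row_cell n v" "Suc 0 \<noteq> tmp_cell n v"
  unfolding var_cell_def row_cell_def tmp_cell_def by simp_all

lemma cell_neq_2 [simp]:
  assumes "0 < n"
  shows "2 \<noteq> var_cell n v" "2 \<noteq> row_cell n v" "2 \<noteq> tmp_cell n v"
    "var_cell n v \<noteq> 2" "row_cell n v \<noteq> 2" "tmp_cell n v \<noteq> 2"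
  using assms unfolding var_cell_def row_cell_def tmp_cell_def by simp_all

lemma aval_cells:
  assumes "s 2 = n * n + 2"
  shows "aval (var v) s = var_cell n v" "aval (row v) s = row_cell n v" "aval (tmp v) s = tmp_cell n v"
  using assms unfolding var_def row_def tmp_def var_cell_def row_cell_def tmp_cell_def by simp_all

text \<open>
  Only matrix entries below the diagonal are read. Row \<open>0\<close> is therefore never needed, and the
  output may overwrite it while the computation is still going on.
\<close>

definition ready :: "nat \<Rightarrow> nat \<Rightarrow> (nat \<Rightarrow> nat \<Rightarrow> bool) \<Rightarrow> memory \<Rightarrow> bool" where
  "ready n k r s \<longleftrightarrow> s 0 = n \<and> s 1 = k \<and> s 2 = n * n + 2 \<and>
    (\<forall>i<n. \<forall>j<i. s (2 + (i * n + j)) = of_bool (r i j)) \<and>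
    (\<forall>v. s (var_cell n v) < n \<and> s (row_cell n v) = s (var_cell n v) * n)"

definition agree :: "nat \<Rightarrow> nat \<Rightarrow> memory \<Rightarrow> memory \<Rightarrow> bool" where
  "agree n d s s' \<longleftrightarrow> (\<forall>x. (\<forall>j\<ge>d. x \<noteq> tmp_cell n j) \<longrightarrow> s' x = s x)"

definition env :: "nat \<Rightarrow> memory \<Rightarrow> nat \<Rightarrow> nat" where
  "env n s v = s (var_cell n v)"

lemma agree_refl: "agree n d s s"
  unfolding agree_def by blast

lemma agree_trans: "agree n d s s' \<Longrightarrow> agree n d s' s'' \<Longrightarrow> agree n d s s''"
  unfolding agree_def by metis

lemma agree_mono: "agree n d' s s' \<Longrightarrow> d \<le> d' \<Longrightarrow> agree n d s s'"
  unfolding agree_def by (meson order_trans)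

lemma agree_upd: "agree n d s s' \<Longrightarrow> d \<le> j \<Longrightarrow> agree n d s (s'(tmp_cell n j := y))"
  unfolding agree_def by auto

lemma matrix_address: "i < n \<Longrightarrow> j < n \<Longrightarrow> 2 + (i * n + j) < n * n + (2::nat)"
proof -
  assume "i < n" "j < n"
  then have "i * n + j < Suc i * n" by simp
  also have "\<dots> \<le> n * n" using \<open>i < n\<close> by (intro mult_right_mono) auto
  finally show ?thesis by simp
qed

lemma agree_low: "agree n d s s' \<Longrightarrow> x < n * n + 2 \<Longrightarrow> s' x = s x"
  unfolding agree_def using cell_gt by (metis less_irrefl)

lemma agree_cells:
  assumes "agree n d s s'"
  shows "s' (var_cell n v) = s (var_cell n v)" "s' (row_cell n v) = s (row_cell n v)"
    "j < d \<Longrightarrow> s' (tmp_cell n j) = s (tmp_cell n j)"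
  using assms unfolding agree_def by auto

lemma env_agree: "agree n d s s' \<Longrightarrow> env n s' = env n s"
  using agree_cells(1) unfolding env_def by blast

lemma ready_pos: "ready n k r s \<Longrightarrow> 0 < n"
  unfolding ready_def by auto

lemma ready_base: "ready n k r s \<Longrightarrow> s 2 = n * n + 2"
  unfolding ready_def by auto

lemma ready_agree:
  assumes "ready n k r s" "agree n d s s'"
  shows "ready n k r s'"
proof -
  have n: "0 < n" using ready_pos[OF assms(1)] .
  have "s' (2 + (i * n + j)) = s (2 + (i * n + j))" if "i < n" "j < i" for i j
    by (rule agree_low[OF assms(2) matrix_address]) (use that in auto)
  then show ?thesis
    using assms(1) agree_low[OF assms(2), of 0] agree_low[OF assms(2), of 1]
      agree_low[OF assms(2), of 2] n
    unfolding ready_def agree_cells(1,2)[OF assms(2)] by simp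
qed

lemma runs_store_tmp:
  assumes "ready n k r s" "aval a s = x"
  shows "runs (Assign (tmp d) a) s 1 (\<lambda>s'. s' (tmp_cell n d) = x \<and> agree n d s s')"
  by (rule runs_Assign)
    (use assms agree_upd[OF agree_refl, of d d] in \<open>simp add: aval_cells(3)[where n = n and s = s, OF ready_base[OF assms(1)]] del: aval.simps\<close>)

lemma ready_loop_body:
  assumes "ready n k r s" "i < n"
    and "\<And>x. (\<forall>j\<ge>d. x \<noteq> tmp_cell n j) \<Longrightarrow> x \<noteq> var_cell n v \<Longrightarrow> x \<noteq> row_cell n v \<Longrightarrow> s' x = s x"
    and "s' (var_cell n v) = i" "s' (row_cell n v) = i * n"
  shows "ready n k r s'" "env n s' = (env n s)(v := i)"
proof -
  have n: "0 < n" using assms by auto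
  have low: "s' x = s x" if "x < n * n + 2" for x
    using cell_gt[OF that] by (intro assms(3)) auto
  have u: "s' (var_cell n u) = s (var_cell n u) \<and> s' (row_cell n u) = s (row_cell n u)"
    if "u \<noteq> v" for u
    using that by (auto intro!: assms(3))
  have "s' (2 + (i' * n + j)) = of_bool (r i' j)" if "i' < n" "j < i'" for i' j
    using low[OF matrix_address[of i' n j]] assms(1) that unfolding ready_def by simp
  moreover have "s' (var_cell n u) < n \<and> s' (row_cell n u) = s' (var_cell n u) * n" for u
    using assms(1,2,4,5) u[of u] unfolding ready_def by (cases "u = v") simp_all
  moreover have "s' 0 = n" "s' 1 = k" "s' 2 = n * n + 2"
    using assms(1) low[of 0] low[of 1] low[of 2] n unfolding ready_def by auto
  ultimately show "ready n k r s'"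
    unfolding ready_def by blast
  show "env n s' = (env n s)(v := i)"
    using assms(4) u unfolding env_def by auto
qed

lemma runs_step:
  assumes "s 2 = n * n + 2" "0 < n" "s 0 = n"
    and "s (var_cell n v) = i" "s (row_cell n v) = i * n"
  shows "runs (step v) s 2 (\<lambda>s'. s' = s(var_cell n v := Suc i, row_cell n v := Suc i * n))"
proof -
  have "runs (step v) s (1 + 1) (\<lambda>s'. s' = s(var_cell n v := Suc i, row_cell n v := Suc i * n))"
    unfolding step_def
    by (rule runs_Assign_Seq, rule runs_Assign) (use assms in \<open>simp add: aval_cells[where n = n] add.commute\<close>)
  then show ?thesis by (simp add: numeral_2_eq_2)
qed

text \<open>Symmetry of \<open>r\<close> allows reading the entry below the diagonal for either
  order of the arguments, and irreflexivity settles equal arguments without a memory access. The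
  frame condition \<open>agree\<close> preserves \<open>ready\<close> and \<open>env\<close>, which
  is what lets operands be evaluated one after the other.\<close>

lemma compile_correct:
  assumes sym: "\<And>i j. r i j = r j i" and irr: "\<And>i. \<not> r i i"
    and "ready n k r s"
  shows "runs (compile d e) s (poly (cost e) n)
    (\<lambda>s'. s' (tmp_cell n d) = eval n k r e (env n s) \<and> agree n d s s')"
  using assms(3)
proof (induction e arbitrary: d s)
  case (Num c)
  then show ?case unfolding compile.simps cost.simps
    by (simp, intro runs_store_tmp[simplified]) auto
next
  case Param
  then show ?case unfolding compile.simps cost.simps
    by (simp, intro runs_store_tmp[simplified]) (assumption, simp add: ready_def)
next
  case (Var v)
  then show ?case unfolding compile.simps cost.simps
    by (simp, intro runs_store_tmp[simplified])
      (assumption, simp add: aval_cells(1)[where n = n and s = s, OF ready_base[OF Var]] env_def)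
next
  case (Adj u v)
  note cells = aval_cells[where n = n and s = s, OF ready_base[OF Adj]]
  let ?u = "env n s u" and ?v = "env n s v"
  let ?Q = "\<lambda>s'. s' (tmp_cell n d) = eval n k r (Adj u v) (env n s) \<and> agree n d s s'"
  have uv: "?u < n" "?v < n" "s (row_cell n u) = ?u * n" "s (row_cell n v) = ?v * n"
    using Adj unfolding ready_def env_def by blast+
  have m: "\<And>i j. i < n \<Longrightarrow> j < i \<Longrightarrow> s (2 + (i * n + j)) = of_bool (r i j)"
    using Adj unfolding ready_def by blast
  have val: "aval (Mem (var w)) s = env n s w" "aval (Mem (row w)) s = s (row_cell n w)" for w
    using cells unfolding env_def by (metis aval.simps(2))+
  have "runs (compile d (Adj u v)) s (1 + (1 + 1)) ?Q"
    unfolding compile.simps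
  proof (rule runs_If)
    assume "aval (Sub (Mem (var u)) (Mem (var v))) s \<noteq> 0"
    then have "?v < ?u" using val(1)[of u] val(1)[of v] by simp
    then have "s (2 + (?u * n + ?v)) = of_bool (r ?u ?v)" using m uv by blast
    then have "aval (Mem (Add (Const 2) (Add (Mem (row u)) (Mem (var v))))) s = of_bool (r ?u ?v)"
      using uv val(2)[of u] val(1)[of v] by simp
    from runs_store_tmp[OF Adj this, of d]
    show "runs (Assign (tmp d) (Mem (Add (Const 2) (Add (Mem (row u)) (Mem (var v)))))) s (1 + 1) ?Q"
      by (rule runs_weaken) auto
  next
    assume le: "aval (Sub (Mem (var u)) (Mem (var v))) s = 0"
    show "runs (If (Sub (Mem (var v)) (Mem (var u)))
        (Assign (tmp d) (Mem (Add (Const 2) (Add (Mem (row v)) (Mem (var u))))))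
        (Assign (tmp d) (Const 0))) s (1 + 1) ?Q"
    proof (rule runs_If)
      assume "aval (Sub (Mem (var v)) (Mem (var u))) s \<noteq> 0"
      then have "?u < ?v" using val(1)[of u] val(1)[of v] by simp
      then have "s (2 + (?v * n + ?u)) = of_bool (r ?u ?v)" using m[of ?v ?u] uv(2) unfolding sym[of ?u ?v] by blast
      then have "aval (Mem (Add (Const 2) (Add (Mem (row v)) (Mem (var u))))) s = of_bool (r ?u ?v)"
        using uv val(2)[of v] val(1)[of u] by simp
      from runs_store_tmp[OF Adj this, of d]
      show "runs (Assign (tmp d) (Mem (Add (Const 2) (Add (Mem (row v)) (Mem (var u)))))) s 1 ?Q"
        by (rule runs_weaken) auto
    next
      assume "aval (Sub (Mem (var v)) (Mem (var u))) s = 0"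
      with le have "?u = ?v" using val(1)[of u] val(1)[of v] by simp
      then have "aval (Const 0) s = of_bool (r ?u ?v)" by (simp add: irr)
      from runs_store_tmp[OF Adj this, of d]
      show "runs (Assign (tmp d) (Const 0)) s 1 ?Q"
        by (rule runs_weaken) auto
    qed
  qed
  then show ?case by (simp add: numeral_3_eq_3)
next
  case (Add_expr a b)
  have "runs (compile d (Add_expr a b)) s (poly (cost a) n + (poly (cost b) n + 1))
    (\<lambda>s'. s' (tmp_cell n d) = eval n k r (Add_expr a b) (env n s) \<and> agree n d s s')"
    unfolding compile.simps
  proof (rule runs_Seq[OF Add_expr.IH(1)[OF Add_expr.prems]])
    fix s1 assume s1: "s1 (tmp_cell n d) = eval n k r a (env n s) \<and> agree n d s s1"
    then have r1: "ready n k r s1" using ready_agree Add_expr.prems by blast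
    show "runs (Seq (compile (Suc d) b) (Assign (tmp d) (Add (Mem (tmp d)) (Mem (tmp (Suc d))))))
      s1 (poly (cost b) n + 1) (\<lambda>s'. s' (tmp_cell n d) = eval n k r (Add_expr a b) (env n s) \<and> agree n d s s')"
    proof (rule runs_Seq[OF Add_expr.IH(2)[OF r1]])
      fix s2 assume s2: "s2 (tmp_cell n (Suc d)) = eval n k r b (env n s1) \<and> agree n (Suc d) s1 s2"
      then have r2: "ready n k r s2" using ready_agree r1 by blast
      have ag: "agree n d s s2"
        using agree_trans[of n d s s1 s2] agree_mono[of n "Suc d" s1 s2 d] s1 s2 by simp
      have "aval (Add (Mem (tmp d)) (Mem (tmp (Suc d)))) s2 = eval n k r (Add_expr a b) (env n s)"
        using aval_cells(3)[where n = n and s = s2, OF ready_base[OF r2]] s1 s2 env_agree[of n d s s1]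
          agree_cells(3)[of n "Suc d" s1 s2 d] by simp
      from runs_store_tmp[OF r2 this, of d]
      show "runs (Assign (tmp d) (Add (Mem (tmp d)) (Mem (tmp (Suc d))))) s2 1
        (\<lambda>s'. s' (tmp_cell n d) = eval n k r (Add_expr a b) (env n s) \<and> agree n d s s')"
        by (rule runs_weaken) (use agree_trans[OF ag] in auto)
    qed
  qed
  then show ?case by (simp add: add.assoc)
next
  case (Sub_expr a b)
  have "runs (compile d (Sub_expr a b)) s (poly (cost a) n + (poly (cost b) n + 1))
    (\<lambda>s'. s' (tmp_cell n d) = eval n k r (Sub_expr a b) (env n s) \<and> agree n d s s')"
    unfolding compile.simps
  proof (rule runs_Seq[OF Sub_expr.IH(1)[OF Sub_expr.prems]])
    fix s1 assume s1: "s1 (tmp_cell n d) = eval n k r a (env n s) \<and> agree n d s s1"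
    then have r1: "ready n k r s1" using ready_agree Sub_expr.prems by blast
    show "runs (Seq (compile (Suc d) b) (Assign (tmp d) (Sub (Mem (tmp d)) (Mem (tmp (Suc d))))))
      s1 (poly (cost b) n + 1) (\<lambda>s'. s' (tmp_cell n d) = eval n k r (Sub_expr a b) (env n s) \<and> agree n d s s')"
    proof (rule runs_Seq[OF Sub_expr.IH(2)[OF r1]])
      fix s2 assume s2: "s2 (tmp_cell n (Suc d)) = eval n k r b (env n s1) \<and> agree n (Suc d) s1 s2"
      then have r2: "ready n k r s2" using ready_agree r1 by blast
      have ag: "agree n d s s2"
        using agree_trans[of n d s s1 s2] agree_mono[of n "Suc d" s1 s2 d] s1 s2 by simp
      have "aval (Sub (Mem (tmp d)) (Mem (tmp (Suc d)))) s2 = eval n k r (Sub_expr a b) (env n s)"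
        using aval_cells(3)[where n = n and s = s2, OF ready_base[OF r2]] s1 s2 env_agree[of n d s s1]
          agree_cells(3)[of n "Suc d" s1 s2 d] by simp
      from runs_store_tmp[OF r2 this, of d]
      show "runs (Assign (tmp d) (Sub (Mem (tmp d)) (Mem (tmp (Suc d))))) s2 1
        (\<lambda>s'. s' (tmp_cell n d) = eval n k r (Sub_expr a b) (env n s) \<and> agree n d s s')"
        by (rule runs_weaken) (use agree_trans[OF ag] in auto)
    qed
  qed
  then show ?case by (simp add: add.assoc)
next
  case (Cond c a b)
  let ?Q = "\<lambda>s'. s' (tmp_cell n d) = eval n k r (Cond c a b) (env n s) \<and> agree n d s s'"
  have "runs (compile d (Cond c a b)) s (poly (cost c) n + (1 + (poly (cost a) n + poly (cost b) n))) ?Q"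
    unfolding compile.simps
  proof (rule runs_Seq[OF Cond.IH(1)[OF Cond.prems]])
    fix s1 assume s1: "s1 (tmp_cell n d) = eval n k r c (env n s) \<and> agree n d s s1"
    then have r1: "ready n k r s1" using ready_agree Cond.prems by blast
    have test: "aval (Mem (tmp d)) s1 = eval n k r c (env n s)"
      using aval_cells(3)[where n = n and s = s1, OF ready_base[OF r1]] s1 by simp
    show "runs (If (Mem (tmp d)) (compile d a) (compile d b)) s1
      (1 + (poly (cost a) n + poly (cost b) n)) ?Q"
    proof (rule runs_If)
      assume "aval (Mem (tmp d)) s1 \<noteq> 0"
      then show "runs (compile d a) s1 (poly (cost a) n + poly (cost b) n) ?Q"
        by (intro runs_weaken[OF Cond.IH(2)[OF r1]])
          (use test s1 env_agree[of n d s s1] agree_trans[of n d s s1] in auto)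
    next
      assume "aval (Mem (tmp d)) s1 = 0"
      then show "runs (compile d b) s1 (poly (cost a) n + poly (cost b) n) ?Q"
        by (intro runs_weaken[OF Cond.IH(3)[OF r1]])
          (use test s1 env_agree[of n d s s1] agree_trans[of n d s s1] in auto)
    qed
  qed
  then show ?case by (simp add: add.assoc add.commute add.left_commute)
next
  case (Loop b v e)
  define f where "f = (\<lambda>i. eval n k r e ((env n s)(v := i)))"
  \<comment> \<open>\<open>ready\<close> is not part of the invariant: on exit the variable equals
    \<open>n\<close>, which \<open>ready\<close> forbids. It is recovered from the invariant in each
    round with \<open>i < n\<close>.\<close>
  define J where "J i s' \<longleftrightarrow>
      (\<forall>x. (\<forall>j\<ge>d. x \<noteq> tmp_cell n j) \<longrightarrow> x \<noteq> var_cell n v \<longrightarrow> x \<noteq> row_cell n v \<longrightarrow> s' x = s x) \<and>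
      s' (var_cell n v) = i \<and> s' (row_cell n v) = i * n \<and> s' (tmp_cell n d) = accum b f i \<and>
      s' (tmp_cell n (d + 1)) = s (var_cell n v) \<and> s' (tmp_cell n (d + 2)) = s (row_cell n v)"
    for i s'
  have n: "0 < n" using ready_pos[OF Loop.prems] .
  have low: "s' 2 = n * n + 2 \<and> s' 0 = n" if "J i s'" for i s'
    using that n Loop.prems unfolding J_def ready_def by simp
  let ?body = "Seq (compile (d + 3) e)
      (Seq (If (if b then Mem (tmp d) else Const 0)
        (Assign (tmp d) (Mem (tmp d)))
        (Assign (tmp d) (Add (Mem (tmp d)) (Mem (tmp (d + 3))))))
      (step v))"
  let ?Q = "\<lambda>s'. s' (tmp_cell n d) = eval n k r (Loop b v e) (env n s) \<and> agree n d s s'"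
  have body: "runs ?body s1 (poly (cost e) n + ((1 + 1) + 2)) (J (Suc i))" if i: "i < n" and J: "J i s1" for i s1
  proof -
    have r1: "ready n k r s1" and e1: "env n s1 = (env n s)(v := i)"
      using ready_loop_body[OF Loop.prems i, of d v s1] J unfolding J_def by blast+
    show ?thesis
    proof (rule runs_Seq[OF Loop.IH[OF r1]])
      fix s2 assume s2: "s2 (tmp_cell n (d + 3)) = eval n k r e (env n s1) \<and> agree n (d + 3) s1 s2"
      have ag: "agree n (d + 3) s1 s2" and fi: "s2 (tmp_cell n (d + 3)) = f i"
        using s2 e1 unfolding f_def by auto
      have J2: "J i s2"
        using J agree_cells[OF ag] ag unfolding J_def agree_def by simp
      have acc: "s2 (tmp_cell n d) = accum b f i" using J2 unfolding J_def by blast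
      have c2: "aval (tmp j) s2 = tmp_cell n j" for j
        using aval_cells(3)[where n = n] low[OF J2] by blast
      show "runs (Seq (If (if b then Mem (tmp d) else Const 0)
        (Assign (tmp d) (Mem (tmp d)))
        (Assign (tmp d) (Add (Mem (tmp d)) (Mem (tmp (d + 3))))))
      (step v)) s2 ((1 + 1) + 2) (J (Suc i))"
      proof (rule runs_Seq[where P = "\<lambda>s'. s' = s2(tmp_cell n d := accum b f (Suc i))"])
        show "runs (If (if b then Mem (tmp d) else Const 0)
          (Assign (tmp d) (Mem (tmp d)))
          (Assign (tmp d) (Add (Mem (tmp d)) (Mem (tmp (d + 3)))))) s2 (1 + 1)
          (\<lambda>s'. s' = s2(tmp_cell n d := accum b f (Suc i)))"
          by (rule runs_If; rule runs_Assign) (use acc in \<open>simp_all add: c2 fi split: if_splits\<close>)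
      next
        fix s3 assume s3: "s3 = s2(tmp_cell n d := accum b f (Suc i))"
        show "runs (step v) s3 2 (J (Suc i))"
        proof (rule runs_weaken[OF runs_step[where i = i]])
          show "s3 2 = n * n + 2" "s3 0 = n" "0 < n"
            using low[OF J2] n unfolding s3 by simp_all
          show "s3 (var_cell n v) = i" "s3 (row_cell n v) = i * n"
            using J2 unfolding s3 J_def by simp_all
          fix s4 assume s4: "s4 = s3(var_cell n v := Suc i, row_cell n v := Suc i * n)"
          have "s4 x = s x" if "\<forall>j\<ge>d. x \<noteq> tmp_cell n j" "x \<noteq> var_cell n v" "x \<noteq> row_cell n v" for x
            using J2 that unfolding s4 s3 J_def by simp
          moreover have "s4 (tmp_cell n d) = accum b f (Suc i)"
            unfolding s4 s3 by simp
          moreover have "s4 (tmp_cell n (d + 1)) = s (var_cell n v)" "s4 (tmp_cell n (d + 2)) = s (row_cell n v)"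
            using J2 unfolding s4 s3 J_def by simp_all
          ultimately show "J (Suc i) s4"
            unfolding J_def by (simp add: s4)
        qed simp
      qed
    qed
  qed
  let ?c = "poly (cost e) n + 4"
  have loop: "runs (While (Sub vertices (Mem (var v))) ?body) s1 (1 + (n - 0) * (1 + ?c)) (J n)"
    if J: "J 0 s1" for s1
  proof (rule runs_While[where J = J, OF J])
    fix i s' assume i: "i < n" "J i s'"
    have "aval (Mem (var v)) s' = i"
      using aval_cells(1)[of s' n v] low[OF i(2)] i(2) unfolding J_def by simp
    then have "aval (Sub vertices (Mem (var v))) s' \<noteq> 0"
      using i low[OF i(2)] by simp
    then show "aval (Sub vertices (Mem (var v))) s' \<noteq> 0 \<and> runs ?body s' ?c (J (Suc i))"
      using body[OF i] by (simp add: numeral_eq_Suc)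
  next
    fix s' assume i: "J n s'"
    have "aval (Mem (var v)) s' = n"
      using aval_cells(1)[of s' n v] low[OF i] i unfolding J_def by simp
    then show "aval (Sub vertices (Mem (var v))) s' = 0"
      using low[OF i] by simp
  qed simp
  have init: "J 0 (s(tmp_cell n (d + 1) := s (var_cell n v), tmp_cell n (d + 2) := s (row_cell n v),
    tmp_cell n d := 0, var_cell n v := 0, row_cell n v := 0))" (is "J 0 ?s")
    unfolding J_def by auto
  have fin: "runs (Seq (Assign (var v) (Mem (tmp (d + 1)))) (Assign (row v) (Mem (tmp (d + 2))))) s1 (1 + 1) ?Q"
    if J: "J n s1" for s1
  proof (rule runs_Assign_Seq, rule runs_Assign)
    let ?s2 = "s1(aval (var v) s1 := aval (Mem (tmp (d + 1))) s1)"
    have 1: "?s2 = s1(var_cell n v := s (var_cell n v))"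
      using aval_cells[of s1 n] low[OF J] J unfolding J_def by simp
    have low2: "?s2 2 = n * n + 2"
      unfolding 1 using low[OF J] n by simp
    have "aval (row v) ?s2 = row_cell n v"
      using low2 by (rule aval_cells(2))
    moreover have "aval (tmp (d + 2)) ?s2 = tmp_cell n (d + 2)"
      using low2 by (rule aval_cells(3))
    moreover have "?s2 (tmp_cell n (d + 2)) = s (row_cell n v)"
      unfolding 1 using J unfolding J_def by simp
    ultimately have 2: "?s2(aval (row v) ?s2 := aval (Mem (tmp (d + 2))) ?s2) =
      s1(var_cell n v := s (var_cell n v), row_cell n v := s (row_cell n v))"
      using 1 unfolding aval.simps(2) by (simp only:)
    show "?Q (?s2(aval (row v) ?s2 := aval (Mem (tmp (d + 2))) ?s2))"
      unfolding 2 using J unfolding J_def agree_def by (auto simp: f_def)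
  qed
  have "runs (compile d (Loop b v e)) s (1 + (1 + (1 + (1 + (1 + ((1 + (n - 0) * (1 + ?c)) + (1 + 1))))))) ?Q"
    unfolding compile.simps
    apply (rule runs_Assign_Seq)+
    apply (rule runs_Seq[OF loop fin])
    subgoal
      using init ready_base[OF Loop.prems] n
      by (simp add: aval_cells[where n = n])
    by assumption
  then show ?case
    by (rule runs_weaken) (auto simp: algebra_simps)
qed

text \<open>
  Cell \<open>n + 3\<close>, the second diagonal entry of the matrix, serves as the counter.
\<close>

definition square :: com where
  "square = Seq (While (Sub vertices (Mem (Add vertices (Const 3))))
      (Seq (Assign (Const 2) (Add (Mem (Const 2)) vertices))
        (Assign (Add vertices (Const 3)) (Add (Mem (Add vertices (Const 3))) (Const 1)))))
    (Assign (Const 2) (Add (Mem (Const 2)) (Const 2)))"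

definition output_loop :: "nat \<Rightarrow> expr \<Rightarrow> com" where
  "output_loop v e = While (Sub vertices (Mem (var v)))
    (Seq (compile 3 e)
    (Seq (Assign (Add (Mem (var v)) (Const 1)) (Sub (Mem (tmp 3)) (Const 1)))
      (step v)))"

text \<open>
  Cells \<open>0\<close>, \<open>1\<close> and \<open>2\<close> hold \<open>n\<close>, \<open>k\<close> and the base address, so they receive their output last.
  The value \<open>0\<close> of \<open>e\<close> is reserved for an unsuccessful search, hence the shift by one.
\<close>

definition tabulate :: "nat \<Rightarrow> expr \<Rightarrow> expr \<Rightarrow> com" where
  "tabulate v h e =
    Seq square
    (Seq (compile 0 h)
    (Seq (compile 1 e)
    (Seq (step v)
    (Seq (compile 2 e)
    (Seq (step v)
    (Seq (output_loop v e)
    (Seq (Assign (Const 1) (Sub (Mem (tmp 1)) (Const 1)))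
    (Seq (Assign (Const 0) (Mem (tmp 0)))
      (Assign (Const 2) (Sub (Mem (tmp 2)) (Const 1)))))))))))"

definition tabulate_cost :: "expr \<Rightarrow> expr \<Rightarrow> nat poly" where
  "tabulate_cost h e = [:10:] + cost h + cost e + cost e + [:0, 1:] * (cost e + [:8:])"

section \<open>Correctness of the squaring and output code\<close>

definition counting :: "nat \<Rightarrow> nat \<Rightarrow> (nat \<Rightarrow> nat \<Rightarrow> bool) \<Rightarrow> nat \<Rightarrow> nat \<Rightarrow> memory \<Rightarrow> bool" where
  "counting n k r v i s \<longleftrightarrow> s 0 = n \<and> s 1 = k \<and> s 2 = n * n + 2 \<and>
    (\<forall>i<n. \<forall>j<i. s (2 + (i * n + j)) = of_bool (r i j)) \<and>
    (\<forall>u. u \<noteq> v \<longrightarrow> s (var_cell n u) = 0 \<and> s (row_cell n u) = 0) \<and>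
    s (var_cell n v) = i \<and> s (row_cell n v) = i * n"

text \<open>\<open>counting\<close> also covers \<open>i = n\<close>, the state in which the output
  loop stops; only below \<open>n\<close> does it provide a state in which expressions can be
  evaluated.\<close>

lemma counting_ready:
  assumes "counting n k r v i s" "i < n"
  shows "ready n k r s" "env n s = (\<lambda>_. 0)(v := i)"
proof -
  have "s (var_cell n u) < n \<and> s (row_cell n u) = s (var_cell n u) * n" for u
    using assms unfolding counting_def by (cases "u = v") auto
  then show "ready n k r s"
    using assms(1) unfolding counting_def ready_def by blast
  show "env n s = (\<lambda>_. 0)(v := i)"
    using assms(1) unfolding counting_def env_def by auto
qed

text \<open>The cells from \<open>3\<close> to \<open>n + 1\<close> are left free. They belong to
  row \<open>0\<close> of the matrix, and the output for the vertices from number \<open>2\<close>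
  on is written there.\<close>

lemma counting_cong:
  assumes "counting n k r v i s" "0 < n"
    and "s' 0 = s 0" "s' 1 = s 1" "s' 2 = s 2"
    and low: "\<And>x. n + 2 \<le> x \<Longrightarrow> x < n * n + 2 \<Longrightarrow> s' x = s x"
    and "\<And>u. s' (var_cell n u) = s (var_cell n u)" "\<And>u. s' (row_cell n u) = s (row_cell n u)"
  shows "counting n k r v i s'"
proof -
  have "s' (2 + (i * n + j)) = of_bool (r i j)" if "i < n" "j < i" for i j
  proof -
    have "n + 2 \<le> 2 + (i * n + j)" using that by (cases i) auto
    then have "s' (2 + (i * n + j)) = s (2 + (i * n + j))"
      using matrix_address[of i n j] that by (intro low) auto
    then show ?thesis
      using that assms(1) unfolding counting_def by simp
  qed
  then show ?thesis
    using assms unfolding counting_def by simp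
qed

lemma counting_agree:
  assumes "counting n k r v i s" "0 < n" "agree n d s s'"
  shows "counting n k r v i s'"
  by (rule counting_cong[OF assms(1,2)])
    (use assms(2) agree_low[OF assms(3)] agree_cells[OF assms(3)] in auto)

lemma runs_step_counting:
  assumes "counting n k r v i s" "0 < n"
  shows "runs (step v) s 2 (\<lambda>s'. counting n k r v (Suc i) s' \<and>
    (\<forall>d. s' (tmp_cell n d) = s (tmp_cell n d)) \<and> (\<forall>x<n * n + 2. s' x = s x))"
proof (rule runs_weaken[OF runs_step])
  fix s' assume s': "s' = s(var_cell n v := Suc i, row_cell n v := Suc i * n)"
  have low: "s' x = s x" if "x < n * n + 2" for x
    using cell_gt[OF that, of v] unfolding s' by simp
  have "s' (2 + (i * n + j)) = of_bool (r i j)" if "i < n" "j < i" for i j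
    using low[OF matrix_address[of i n j]] that assms(1) unfolding counting_def by simp
  moreover have "s' 0 = n" "s' 1 = k" "s' 2 = n * n + 2"
    using assms unfolding counting_def s' by auto
  ultimately show "counting n k r v (Suc i) s' \<and>
      (\<forall>d. s' (tmp_cell n d) = s (tmp_cell n d)) \<and> (\<forall>x<n * n + 2. s' x = s x)"
    using assms low unfolding counting_def by (simp add: s')
qed (use assms in \<open>auto simp: counting_def\<close>)

lemma runs_square:
  assumes n: "2 \<le> n" and s: "s 0 = n" "s 1 = k" "s 2 = 0" "s (n + 3) = 0"
    and mat: "\<And>i j. i < n \<Longrightarrow> j < i \<Longrightarrow> s (2 + (i * n + j)) = of_bool (r i j)"
    and zero: "\<And>x. n * n + 2 \<le> x \<Longrightarrow> s x = 0"
  shows "runs square s (2 + n * 3) (counting n k r v 0)"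
proof -
  have n3: "n + 3 < n * n + 2"
  proof -
    have "2 * n \<le> n * n" using n by (intro mult_right_mono) auto
    then show ?thesis using n by linarith
  qed
  define J where "J i s' \<longleftrightarrow> s' = s(2 := i * n, n + 3 := i)" for i s'
  have "runs (While (Sub vertices (Mem (Add vertices (Const 3))))
      (Seq (Assign (Const 2) (Add (Mem (Const 2)) vertices))
        (Assign (Add vertices (Const 3)) (Add (Mem (Add vertices (Const 3))) (Const 1)))))
    s (1 + (n - 0) * (1 + 2)) (J n)"
  proof (rule runs_While)
    show "J 0 s" using s unfolding J_def by auto
    fix i s1 assume i: "i < n" "J i s1"
    have "runs (Seq (Assign (Const 2) (Add (Mem (Const 2)) vertices))
        (Assign (Add vertices (Const 3)) (Add (Mem (Add vertices (Const 3))) (Const 1))))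
      s1 (1 + 1) (J (Suc i))"
      by (rule runs_Assign_Seq, rule runs_Assign)
        (use i s n in \<open>auto simp: J_def fun_eq_iff\<close>)
    then show "aval (Sub vertices (Mem (Add vertices (Const 3)))) s1 \<noteq> 0 \<and>
      runs (Seq (Assign (Const 2) (Add (Mem (Const 2)) vertices))
        (Assign (Add vertices (Const 3)) (Add (Mem (Add vertices (Const 3))) (Const 1))))
      s1 2 (J (Suc i))"
      using i s unfolding J_def by (simp add: numeral_2_eq_2)
  qed (use s in \<open>auto simp: J_def\<close>)
  then have "runs square s ((1 + (n - 0) * (1 + 2)) + 1) (counting n k r v 0)"
    unfolding square_def
  proof (rule runs_Seq)
    fix s1 assume "J n s1"
    define s2 where "s2 = s(2 := n * n + 2, n + 3 := n)"
    have s1: "s1(aval (Const 2) s1 := aval (Add (Mem (Const 2)) (Const 2)) s1) = s2"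
      using \<open>J n s1\<close> n unfolding J_def s2_def by (auto simp: fun_eq_iff)
    have "s2 (2 + (i * n + j)) = of_bool (r i j)" if ij: "i < n" "j < i" for i j
    proof -
      have "i * n + j \<noteq> n + 1"
      proof
        assume eq: "i * n + j = n + 1"
        have "i \<noteq> 0" using ij by auto
        show False
        proof (cases "i = 1")
          case True then show ?thesis using eq ij by auto
        next
          case False
          then have "2 * n \<le> i * n" using \<open>i \<noteq> 0\<close> by (intro mult_right_mono) auto
          then show ?thesis using eq n ij False \<open>i \<noteq> 0\<close> by linarith
        qed
      qed
      moreover have "0 < i * n" using ij by auto
      ultimately show ?thesis using mat[OF ij] unfolding s2_def by auto
    qed
    moreover have "s2 (var_cell n u) = 0" "s2 (row_cell n u) = 0" for u
      using zero[of "var_cell n u"] zero[of "row_cell n u"] n3 n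
      unfolding s2_def var_cell_def row_cell_def by auto
    ultimately have "counting n k r v 0 s2"
      using s unfolding counting_def by (auto simp: s2_def)
    then show "runs (Assign (Const 2) (Add (Mem (Const 2)) (Const 2))) s1 1 (counting n k r v 0)"
      by (intro runs_Assign) (simp only: s1)
  qed
  then show ?thesis by (rule runs_weaken) auto
qed

lemma tabulate_correct:
  assumes sym: "\<And>i j. r i j = r j i" and irr: "\<And>i. \<not> r i i"
    and n: "2 \<le> n" and s: "s 0 = n" "s 1 = k" "s 2 = 0" "s (n + 3) = 0"
    and mat: "\<And>i j. i < n \<Longrightarrow> j < i \<Longrightarrow> s (2 + (i * n + j)) = of_bool (r i j)"
    and zero: "\<And>x. n * n + 2 \<le> x \<Longrightarrow> s x = 0"
  shows "runs (tabulate v h e) s (poly (tabulate_cost h e) n)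
    (\<lambda>s'. s' 0 = eval n k r h (\<lambda>_. 0) \<and> (\<forall>i<n. s' (1 + i) = eval n k r e ((\<lambda>_. 0)(v := i)) - 1))"
    (is "runs _ _ _ ?Q")
proof -
  define H where "H = eval n k r h (\<lambda>_. 0)"
  define F where "F i = eval n k r e ((\<lambda>_. 0)(v := i))" for i
  have n0: "0 < n" using n by simp
  have Z: "(\<lambda>_. 0)(v := 0) = (\<lambda>_. 0::nat)" by auto
  have comp: "runs (compile d e) s1 (poly (cost e) n) (\<lambda>s'. s' (tmp_cell n d) = F i \<and>
    counting n k r v i s' \<and> (\<forall>j<d. s' (tmp_cell n j) = s1 (tmp_cell n j)) \<and> (\<forall>x<n * n + 2. s' x = s1 x))"
    if "counting n k r v i s1" "i < n" for d i s1
    by (rule runs_weaken[OF compile_correct[OF sym irr counting_ready(1)[OF that]]])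
      (use counting_agree[OF that(1) n0] agree_cells(3) agree_low
        counting_ready(2)[OF that] in \<open>auto simp: F_def\<close>)
  have comph: "runs (compile 0 h) s1 (poly (cost h) n) (\<lambda>s'. s' (tmp_cell n 0) = H \<and> counting n k r v 0 s')"
    if "counting n k r v 0 s1" for s1
    by (rule runs_weaken[OF compile_correct[OF sym irr counting_ready(1)[OF that n0]]])
      (use counting_agree[OF that n0] counting_ready(2)[OF that n0] Z in \<open>auto simp: H_def\<close>)
  define J where "J i s' \<longleftrightarrow> 2 \<le> i \<and> counting n k r v i s' \<and> s' (tmp_cell n 0) = H \<and> s' (tmp_cell n 1) = F 0 \<and>
     s' (tmp_cell n 2) = F 1 \<and> (\<forall>j<i. 2 \<le> j \<longrightarrow> s' (1 + j) = F j - 1)" for i s'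
  have loop: "runs (output_loop v e) s1 (1 + (n - 2) * (1 + (poly (cost e) n + (1 + 2)))) (J n)"
    if "J 2 s1" for s1
    unfolding output_loop_def
  proof (rule runs_While[where J = J, OF that n])
    fix i s1 assume i: "i < n" and J: "J i s1"
    then have c: "counting n k r v i s1" unfolding J_def by blast
    have "aval (Mem (var v)) s1 = i"
      using c aval_cells(1)[where s = s1 and n = n] unfolding counting_def by simp
    then have "aval (Sub vertices (Mem (var v))) s1 \<noteq> 0"
      using i c unfolding counting_def by simp
    moreover have "runs (Seq (compile 3 e)
      (Seq (Assign (Add (Mem (var v)) (Const 1)) (Sub (Mem (tmp 3)) (Const 1))) (step v))) s1
      (poly (cost e) n + (1 + 2)) (J (Suc i))" if "2 \<le> i"
    proof (rule runs_Seq[OF comp[OF c i]], elim conjE)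
      fix s2 assume s2: "s2 (tmp_cell n 3) = F i" "counting n k r v i s2"
         "\<forall>j<3. s2 (tmp_cell n j) = s1 (tmp_cell n j)" "\<forall>x<n * n + 2. s2 x = s1 x"
      have i1: "1 + i < n * n + 2" using i matrix_address[of 0 n i] by auto
      show "runs (Seq (Assign (Add (Mem (var v)) (Const 1)) (Sub (Mem (tmp 3)) (Const 1))) (step v))
          s2 (1 + 2) (J (Suc i))"
      proof (rule runs_Assign_Seq)
        let ?s3 = "s2(1 + i := F i - 1)"
        have s3: "s2(aval (Add (Mem (var v)) (Const 1)) s2 := aval (Sub (Mem (tmp 3)) (Const 1)) s2) = ?s3"
          using s2(1,2) aval_cells[where s = s2 and n = n] unfolding counting_def by simp
        have keep: "?s3 (var_cell n u) = s2 (var_cell n u)" "?s3 (row_cell n u) = s2 (row_cell n u)"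
            "?s3 (tmp_cell n u) = s2 (tmp_cell n u)" for u
          using cell_gt[OF i1, of u] by auto
        have c3: "counting n k r v i ?s3"
          by (rule counting_cong[OF s2(2) n0]) (use keep that i in auto)
        show "runs (step v) (s2(aval (Add (Mem (var v)) (Const 1)) s2 := aval (Sub (Mem (tmp 3)) (Const 1)) s2))
            2 (J (Suc i))"
          unfolding s3
        proof (rule runs_weaken[OF runs_step_counting[OF c3 n0]])
          fix s4 assume s4: "counting n k r v (Suc i) s4 \<and>
            (\<forall>d. s4 (tmp_cell n d) = ?s3 (tmp_cell n d)) \<and> (\<forall>x<n * n + 2. s4 x = ?s3 x)"
          have "s4 (1 + j) = F j - 1" if j: "j < Suc i" "2 \<le> j" for j
          proof -
            have "1 + j < n * n + 2" using j i1 by linarith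
            then show ?thesis using s4 s2(4) J j unfolding J_def by (cases "j = i") auto
          qed
          moreover have "s4 (tmp_cell n d) = s1 (tmp_cell n d)" if "d < 3" for d
            using s4 keep(3) s2(3) that by metis
          ultimately show "J (Suc i) s4"
            using s4 J unfolding J_def by simp
        qed simp
      qed
    qed
    moreover have "2 \<le> i" using J unfolding J_def by blast
    ultimately show "aval (Sub vertices (Mem (var v))) s1 \<noteq> 0 \<and> runs (Seq (compile 3 e)
      (Seq (Assign (Add (Mem (var v)) (Const 1)) (Sub (Mem (tmp 3)) (Const 1))) (step v))) s1
      (poly (cost e) n + (1 + 2)) (J (Suc i))" by blast
  next
    fix s1 assume J: "J n s1"
    have "aval (Mem (var v)) s1 = n"
      using J aval_cells(1)[where s = s1 and n = n] unfolding counting_def J_def by simp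
    then show "aval (Sub vertices (Mem (var v))) s1 = 0"
      using J unfolding counting_def J_def by simp
  qed
  \<comment> \<open>Cell \<open>2\<close> is overwritten at the very end, because the address of
    every temporary is computed from it.\<close>
  have fin: "runs (Seq (Assign (Const 1) (Sub (Mem (tmp 1)) (Const 1)))
    (Seq (Assign (Const 0) (Mem (tmp 0)))
      (Assign (Const 2) (Sub (Mem (tmp 2)) (Const 1))))) s1 (1 + (1 + 1)) ?Q" if J: "J n s1" for s1
  proof -
    have b: "s1 2 = n * n + 2" using J unfolding J_def counting_def by blast
    have "s1 (1 + i) = F i - 1" if "2 \<le> i" "i < n" for i
      using J that unfolding J_def by blast
    then have out: "(s1(1 := F 0 - 1, 0 := H, 2 := F 1 - 1)) (1 + i) = F i - 1" if "i < n" for i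
      using that by (cases "i = 0"; cases "i = 1") auto
    show ?thesis
      apply (rule runs_Assign_Seq)
      apply (rule runs_Assign_Seq)
      apply (rule runs_Assign)
      using b J out unfolding J_def
      by (simp add: aval_cells[where n = n] n0 F_def[symmetric] H_def)
  qed
  have "runs (tabulate v h e) s ((2 + n * 3) + (poly (cost h) n + (poly (cost e) n + (2 +
    (poly (cost e) n + (2 + ((1 + (n - 2) * (1 + (poly (cost e) n + (1 + 2)))) + (1 + (1 + 1))))))))) ?Q"
    unfolding tabulate_def
  proof (rule runs_Seq[OF runs_square[where v = v and r = r and k = k and n = n]], (fact assms)+,
      rule runs_Seq[OF comph], assumption, elim conjE, rule runs_Seq[OF comp], assumption,
      rule n0, elim conjE, rule runs_Seq[OF runs_step_counting[OF _ n0]], assumption, elim conjE,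
      rule runs_Seq[OF comp], assumption, use n in simp, elim conjE,
      rule runs_Seq[OF runs_step_counting[OF _ n0]], assumption, elim conjE,
      rule runs_Seq[OF loop _], goal_cases)
    case 1
    then show ?case unfolding J_def by (simp add: numeral_2_eq_2)
  qed (rule fin)
  then show ?thesis
  proof (rule runs_weaken)
    have "(n - 2) * (poly (cost e) n + 4) \<le> n * (poly (cost e) n + 4)"
      by (intro mult_right_mono) auto
    then show "(2 + n * 3) + (poly (cost h) n + (poly (cost e) n + (2 +
      (poly (cost e) n + (2 + ((1 + (n - 2) * (1 + (poly (cost e) n + (1 + 2)))) + (1 + (1 + 1))))))))
      \<le> poly (tabulate_cost h e) n"
      unfolding tabulate_cost_def by (simp add: algebra_simps)
  qed
qed

section \<open>Levels of a sparse path\<close>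

lemma self_in_nodes [simp]: "T \<in> nodes T"
  by (cases T) auto

lemma nodes_trans: "u \<in> nodes w \<Longrightarrow> w \<in> nodes T \<Longrightarrow> u \<in> nodes T"
  by (induction T) auto

lemma child_in_nodes: "w \<in> set (children u) \<Longrightarrow> w \<in> nodes u"
  using self_in_nodes by (cases u) fastforce+

lemma leaves_nodes: "u \<in> nodes T \<Longrightarrow> leaves u \<subseteq> leaves T"
  by (induction T) auto

lemma nodes_cases: "u \<in> nodes T \<Longrightarrow> u = T \<or> (\<exists>c \<in> set (children T). u \<in> nodes c)"
  by (cases T) auto

lemma size_child: "w \<in> set (children u) \<Longrightarrow> size w < size u"
  by (cases u) (auto simp: less_Suc_eq_le size_list_estimation')

lemma size_nodes: "u \<in> nodes T \<Longrightarrow> u = T \<or> size u < size T"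
proof (induction T)
  case (Node l ts)
  then show ?case
    using size_child[of _ "Node l ts"] by fastforce
qed auto

lemma nodes_antisym: "u \<in> nodes w \<Longrightarrow> w \<in> nodes u \<Longrightarrow> u = w"
  using size_nodes by (metis less_asym)

lemma Leaf_in_nodes: "x \<in> leaves T \<Longrightarrow> Leaf x \<in> nodes T"
  by (induction T) auto

text \<open>The part of \<open>is_canonical_cotree\<close> that does not mention the graph. It is
  inherited by all subtrees, which the whole notion is not.\<close>

definition wf_cotree :: "'a cotree \<Rightarrow> bool" where
  "wf_cotree T \<longleftrightarrow> (\<forall>l ts. Node l ts \<in> nodes T \<longrightarrow>
        length ts \<ge> 2 \<and>
        (\<forall>i<length ts. \<forall>j<length ts. i \<noteq> j \<longrightarrow> leaves (ts ! i) \<inter> leaves (ts ! j) = {}) \<and>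
        (\<forall>l' us. Node l' us \<in> set ts \<longrightarrow> l' \<noteq> l))"

lemma wf_cotree_nodes: "wf_cotree T \<Longrightarrow> u \<in> nodes T \<Longrightarrow> wf_cotree u"
  unfolding wf_cotree_def using nodes_trans by blast

lemma wf_cotree_child: "wf_cotree T \<Longrightarrow> c \<in> set (children T) \<Longrightarrow> wf_cotree c"
  using wf_cotree_nodes child_in_nodes by blast

lemma leaves_nonempty: "wf_cotree T \<Longrightarrow> leaves T \<noteq> {}"
proof (induction T)
  case (Node l ts)
  have "length ts \<ge> 2" using Node.prems unfolding wf_cotree_def by simp
  then obtain c where c: "c \<in> set ts" by (cases ts) auto
  then have "wf_cotree c"
    using wf_cotree_child[OF Node.prems] by simp
  then show ?case using Node.IH[OF c] c by auto
qed auto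

lemma children_disjoint:
  assumes "wf_cotree T" "c \<in> set (children T)" "c' \<in> set (children T)"
    and "leaves c \<inter> leaves c' \<noteq> {}"
  shows "c = c'"
proof (cases T)
  case (Node l ts)
  then obtain i j where "i < length ts" "c = ts ! i" "j < length ts" "c' = ts ! j"
    using assms(2,3) by (auto simp: in_set_conv_nth)
  then show ?thesis
    using assms(1,4) Node unfolding wf_cotree_def by (metis self_in_nodes)
qed (use assms in auto)

lemma other_child:
  assumes "wf_cotree T" "c \<in> set (children T)"
  shows "\<exists>y \<in> leaves T. y \<notin> leaves c"
proof (cases T)
  case (Node l ts)
  then obtain i where i: "i < length ts" "c = ts ! i"
    using assms(2) by (auto simp: in_set_conv_nth)
  have wf: "length ts \<ge> 2"
    "\<And>i j. i < length ts \<Longrightarrow> j < length ts \<Longrightarrow> i \<noteq> j \<Longrightarrow> leaves (ts ! i) \<inter> leaves (ts ! j) = {}"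
    using assms(1) Node self_in_nodes unfolding wf_cotree_def by blast+
  define j where "j = (if i = 0 then 1 else 0 :: nat)"
  have j: "j < length ts" "j \<noteq> i"
    using wf(1) i unfolding j_def by auto
  have "wf_cotree (ts ! j)"
    using wf_cotree_child[OF assms(1)] j Node by simp
  then obtain y where y: "y \<in> leaves (ts ! j)" using leaves_nonempty by blast
  have "y \<in> leaves T" using y j Node by auto
  moreover have "y \<notin> leaves c" using wf(2)[OF j(1) i(1) j(2)] y i by blast
  ultimately show ?thesis by blast
qed (use assms in auto)

text \<open>Nodes below different children have disjoint leaf sets, so both nodes stay below a
  common child until one of them is reached.\<close>

lemma nodes_laminar:
  assumes "wf_cotree T" "u \<in> nodes T" "w \<in> nodes T" "leaves u \<inter> leaves w \<noteq> {}"
  shows "u \<in> nodes w \<or> w \<in> nodes u"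
  using assms(1-3)
proof (induction T)
  case (Node l ts)
  show ?case
  proof (cases "u = Node l ts \<or> w = Node l ts")
    case False
    then obtain c c' where c: "c \<in> set ts" "u \<in> nodes c" "c' \<in> set ts" "w \<in> nodes c'"
      using Node.prems(2,3) by auto
    then have "leaves c \<inter> leaves c' \<noteq> {}"
      using assms(4) leaves_nodes[OF c(2)] leaves_nodes[OF c(4)] by blast
    then have "c = c'"
      using children_disjoint[OF Node.prems(1)] c by simp
    then show ?thesis
      using Node.IH[OF c(1)] wf_cotree_child[OF Node.prems(1)] c by simp
  qed (use Node.prems in blast)
qed auto

section \<open>Least common ancestors\<close>

lemma is_lca_unique: "is_lca T x y z \<Longrightarrow> is_lca T x y z' \<Longrightarrow> z = z'"
  unfolding is_lca_def using nodes_antisym by blast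

text \<open>A node properly below \<open>z\<close> with both leaves would lie below a child of
  \<open>z\<close>; because of \<open>x\<close> this child is \<open>c\<close>, which misses
  \<open>y\<close>.\<close>

lemma is_lca_branch:
  assumes wf: "wf_cotree T" and z: "z \<in> nodes T" and c: "c \<in> set (children z)"
    and x: "x \<in> leaves c" and y: "y \<in> leaves z" "y \<notin> leaves c"
  shows "is_lca T x y z"
proof -
  have xz: "x \<in> leaves z" using leaves_nodes[OF child_in_nodes[OF c]] x by blast
  have "z \<in> nodes w" if w: "w \<in> nodes T" "{x, y} \<subseteq> leaves w" for w
  proof (rule ccontr)
    assume "z \<notin> nodes w"
    then have "w \<in> nodes z" "w \<noteq> z"
      using nodes_laminar[OF wf z w(1)] xz w(2) by auto
    then obtain c' where c': "c' \<in> set (children z)" "w \<in> nodes c'"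
      using nodes_cases by blast
    have "c = c'"
      using children_disjoint[OF wf_cotree_nodes[OF wf z] c c'(1)] x w(2) leaves_nodes[OF c'(2)] by blast
    then show False using y(2) w(2) leaves_nodes[OF c'(2)] by blast
  qed
  then show ?thesis using z xz y(1) unfolding is_lca_def by blast
qed

lemma is_lca_exists:
  assumes wf: "wf_cotree T" and "x \<in> leaves T" "y \<in> leaves T"
  shows "\<exists>z. is_lca T x y z"
proof -
  obtain z where z: "z \<in> nodes T" "{x, y} \<subseteq> leaves z"
    and least: "\<And>w. w \<in> nodes T \<Longrightarrow> {x, y} \<subseteq> leaves w \<Longrightarrow> size z \<le> size w"
    using ex_has_least_nat[of "\<lambda>z. z \<in> nodes T \<and> {x, y} \<subseteq> leaves z" T size] assms by auto
  have "z \<in> nodes w" if w: "w \<in> nodes T" "{x, y} \<subseteq> leaves w" for w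
    using nodes_laminar[OF wf z(1) w(1)] z(2) w(2) least[OF w] size_nodes[of w z] by fastforce
  then show ?thesis using z unfolding is_lca_def by blast
qed

text \<open>By laminarity a node that contains \<open>y\<close> and meets \<open>{x, x'}\<close>
  lies above \<open>u\<close>, hence contains both \<open>x\<close> and \<open>x'\<close>. This
  makes the leaf set of every node a module of \<open>H\<close>.\<close>

lemma is_lca_replace:
  assumes wf: "wf_cotree T" and u: "u \<in> nodes T" and x: "x \<in> leaves u" "x' \<in> leaves u"
    and y: "y \<notin> leaves u" and lca: "is_lca T x y z"
  shows "is_lca T x' y z"
proof -
  have sub: "u \<in> nodes w" if "w \<in> nodes T" "x \<in> leaves w \<or> x' \<in> leaves w" "y \<in> leaves w" for w
    using nodes_laminar[OF wf u that(1)] that(2,3) x y leaves_nodes[of w u] by blast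
  have z: "z \<in> nodes T" "x \<in> leaves z" "y \<in> leaves z"
    using lca unfolding is_lca_def by auto
  have "x' \<in> leaves z"
    using leaves_nodes[OF sub[of z]] z x by blast
  moreover have "z \<in> nodes w" if w: "w \<in> nodes T" "{x', y} \<subseteq> leaves w" for w
    using leaves_nodes[OF sub[of w]] lca w x unfolding is_lca_def by blast
  ultimately show ?thesis using z unfolding is_lca_def by blast
qed

section \<open>Descending paths and edit paths\<close>

lemma descending_path_exists:
  assumes "w \<in> nodes u" "u \<in> nodes T"
  shows "\<exists>P. descending_path T P \<and> hd P = u \<and> last P = w"
  using assms
proof (induction u)
  case (Leaf x)
  then show ?case by (intro exI[of _ "[Leaf x]"]) (auto simp: descending_path_def)
next
  case (Node l ts)
  show ?case
  proof (cases "w = Node l ts")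
    case True
    then show ?thesis
      using Node.prems by (intro exI[of _ "[Node l ts]"]) (auto simp: descending_path_def)
  next
    case False
    then obtain c where c: "c \<in> set ts" "w \<in> nodes c" using Node.prems by auto
    have "c \<in> nodes T"
      using c(1) Node.prems(2) nodes_trans[OF child_in_nodes, of c "Node l ts" T] by simp
    then obtain P where P: "descending_path T P" "hd P = c" "last P = w"
      using Node.IH[OF c] by blast
    then have "descending_path T (Node l ts # P)"
      using Node.prems(2) c(1) unfolding descending_path_def by (cases P) auto
    then show ?thesis
      using P by (intro exI[of _ "Node l ts # P"]) (auto simp: descending_path_def)
  qed
qed

lemma path_edges_append: "P \<noteq> [] \<Longrightarrow> R \<noteq> [] \<Longrightarrow> (last P, hd R) \<in> path_edges (P @ R)"
proof (induction P)
  case (Cons a P)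
  then show ?case unfolding path_edges_def by (cases P; cases R) auto
qed simp

text \<open>The least common ancestor lies at or above \<open>u\<close>, since otherwise it would
  lie below \<open>c\<close> and \<open>c\<close> would contain \<open>y\<close>. The edit path is
  glued from a path to \<open>u\<close> and a path from \<open>c\<close> at the edge in
  question.\<close>

lemma edit_path_through:
  assumes wf: "wf_cotree T" and S: "{x, y} \<in> S" "y \<in> leaves T"
    and u: "u \<in> nodes T" and c: "c \<in> set (children u)"
    and x: "x \<in> leaves c" and y: "y \<notin> leaves c"
  shows "\<exists>P. edit_path T S (x, y) P \<and> (u, c) \<in> path_edges P"
proof -
  have cT: "c \<in> nodes T" using nodes_trans[OF child_in_nodes[OF c] u] .
  have xu: "x \<in> leaves u" using leaves_nodes[OF child_in_nodes[OF c]] x by blast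
  obtain z where z: "is_lca T x y z"
    using is_lca_exists[OF wf _ S(2)] leaves_nodes[OF cT] x by blast
  then have zT: "z \<in> nodes T" "x \<in> leaves z" "y \<in> leaves z" unfolding is_lca_def by auto
  have "u \<in> nodes z"
  proof (rule ccontr)
    assume "u \<notin> nodes z"
    then have "z \<in> nodes u" "z \<noteq> u"
      using nodes_laminar[OF wf u zT(1)] xu zT(2) by auto
    then obtain c' where c': "c' \<in> set (children u)" "z \<in> nodes c'"
      using nodes_cases by blast
    have "c = c'"
      using children_disjoint[OF wf_cotree_nodes[OF wf u] c c'(1)] x zT(2) leaves_nodes[OF c'(2)] by blast
    then show False using y zT(3) leaves_nodes[OF c'(2)] by blast
  qed
  then obtain P where P: "descending_path T P" "hd P = z" "last P = u"
    using descending_path_exists zT(1) by blast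
  obtain R where R: "descending_path T R" "hd R = c" "last R = Leaf x"
    using descending_path_exists[OF Leaf_in_nodes[OF x] cT] by blast
  have "descending_path T (P @ R)"
    using P R c unfolding descending_path_def by (auto simp: successively_append_iff)
  then have "edit_path T S (x, y) (P @ R)"
    using P R S(1) z unfolding edit_path_def descending_path_def by auto
  moreover have "(u, c) \<in> path_edges (P @ R)"
    using path_edges_append[of P R] P R unfolding descending_path_def by auto
  ultimately show ?thesis by blast
qed

lemma path_edges_sublist: "sublist Q P \<Longrightarrow> path_edges Q \<subseteq> path_edges P"
proof -
  have step: "path_edges R \<subseteq> path_edges (a # R)" for a and R :: "'b cotree list"
    unfolding path_edges_def by (cases R) auto
  have pre: "path_edges R \<subseteq> path_edges (R' @ R)" for R' and R :: "'b cotree list"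
    using step by (induction R') auto
  have post: "path_edges R \<subseteq> path_edges (R @ R')" for R' and R :: "'b cotree list"
  proof (induction R)
    case (Cons a R)
    then show ?case unfolding path_edges_def by (cases R) auto
  qed (simp add: path_edges_def)
  show "sublist Q P \<Longrightarrow> path_edges Q \<subseteq> path_edges P"
    unfolding sublist_def using pre post by (meson subset_trans)
qed

text \<open>
  What the proof needs from the sparse path \<open>Q\<close>: \<open>L i\<close> is \<open>De(u)\<close> for the \<open>i\<close>-th node \<open>u\<close> of \<open>Q\<close>, counted from
  the top, \<open>join i\<close> says that this node is labelled \<open>OPlus\<close>, \<open>t\<close> is the number of edit paths that share
  an edge with \<open>Q\<close>, and \<open>D\<close> consists of the edited pairs of these edit paths.
\<close>

locale levels =
  fixes V :: "'a set" and E S D :: "'a set set" and k t m :: nat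
    and L :: "nat \<Rightarrow> 'a set" and join :: "nat \<Rightarrow> bool"
  assumes graph: "simple_graph V E"
    and L_sub: "i \<le> m \<Longrightarrow> L i \<subseteq> V"
    and L_desc: "i < m \<Longrightarrow> L (Suc i) \<subset> L i"
    and join_alt: "Suc i < m \<Longrightarrow> join (Suc i) \<longleftrightarrow> \<not> join i"
    and join_adj: "i < m \<Longrightarrow> x \<in> L (Suc i) \<Longrightarrow> y \<in> L i \<Longrightarrow> y \<notin> L (Suc i) \<Longrightarrow>
        {x, y} \<in> sym_diff E S \<longleftrightarrow> join i"
    and L_module: "i \<le> m \<Longrightarrow> x \<in> L i \<Longrightarrow> x' \<in> L i \<Longrightarrow> y \<in> V \<Longrightarrow> y \<notin> L i \<Longrightarrow>
        {x, y} \<in> sym_diff E S \<longleftrightarrow> {x', y} \<in> sym_diff E S"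
    and crossing: "{x, y} \<in> S \<Longrightarrow> 1 \<le> i \<Longrightarrow> i \<le> m \<Longrightarrow> x \<in> L i \<Longrightarrow> y \<notin> L i \<Longrightarrow> {x, y} \<in> D"
    and D_sub: "D \<subseteq> all_pairs V"
    and card_D: "card D \<le> t"
    and edited: "\<exists>x\<in>L m. \<exists>y\<in>V. y \<notin> L 1 \<and> {x, y} \<in> S"
    and large: "k + 2 \<le> card (L m)"
    and t_pos: "1 \<le> t"
    and long: "51 * t \<le> m"

lemma sparse_path_levels:
  assumes graph: "simple_graph V E" and S: "S \<subseteq> all_pairs V"
    and cotree: "is_canonical_cotree T V (sym_diff E S)"
    and sparse: "is_sparse_path 51 T S k Q"
  obtains D t m L join where "levels V E S D k t m L join"
proof -
  define X where "X = {q. \<exists>P. edit_path T S q P \<and> path_edges P \<inter> path_edges Q \<noteq> {}}"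
  define t where "t = card X"
  define m where "m = length Q - 1"
  define L where "L i = leaves (Q ! i)" for i
  define join where "join i \<longleftrightarrow> (\<exists>ts. Q ! i = Node OPlus ts)" for i
  define D where "D = (\<lambda>(x, y). {x, y}) ` X"
  note tree = cotree[unfolded is_canonical_cotree_def, folded wf_cotree_def]
  have leaves: "leaves T = V" and wf: "wf_cotree T"
    using tree[THEN conjunct1] tree[THEN conjunct2, THEN conjunct1] by simp_all
  have adj: "{x, y} \<in> sym_diff E S \<longleftrightarrow> (\<exists>ts. is_lca T x y (Node OPlus ts))"
    if "x \<in> V" "y \<in> V" "x \<noteq> y" for x y
    using tree[THEN conjunct2, THEN conjunct2] that by simp
  have Q: "Q \<noteq> []" "set Q \<subseteq> nodes T" "successively (\<lambda>u w. w \<in> set (children u)) Q"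
    "set Q \<subseteq> T'_nodes T k"
    using sparse unfolding is_sparse_path_def descending_path_def by auto
  have lenQ: "length Q = Suc m" using Q(1) unfolding m_def by simp
  have node: "Q ! i \<in> nodes T" if "i \<le> m" for i
    using Q(2) lenQ that nth_mem[of i Q] by auto
  have child: "Q ! Suc i \<in> set (children (Q ! i))" if "i < m" for i
    using Q(3) lenQ that by (simp add: successively_conv_nth)
  have edge: "(Q ! i, Q ! Suc i) \<in> path_edges Q" if "i < m" for i
  proof -
    have "zip Q (tl Q) ! i = (Q ! i, Q ! Suc i)" "i < length (zip Q (tl Q))"
      using that lenQ by (simp_all add: nth_tl)
    then show ?thesis unfolding path_edges_def by (metis nth_mem)
  qed
  have Lv: "L i \<subseteq> V" if "i \<le> m" for i
    using leaves_nodes[OF node[OF that]] leaves unfolding L_def by simp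
  have finV: "finite V" using graph unfolding simple_graph_def by blast
  have SV: "x \<in> V \<and> y \<in> V \<and> x \<noteq> y" if "{x, y} \<in> S" for x y
    using S that unfolding all_pairs_def by (auto simp: doubleton_eq_iff)
  have XV: "X \<subseteq> V \<times> V" and XS: "D \<subseteq> S"
    using SV unfolding X_def D_def edit_path_def by auto
  have finX: "finite X" using finite_subset[OF XV] finV by blast
  have touched: "{x, y} \<in> D" if "{x, y} \<in> S" "i < m" "x \<in> L (Suc i)" "y \<notin> L (Suc i)" for x y i
  proof -
    have "\<exists>P. edit_path T S (x, y) P \<and> (Q ! i, Q ! Suc i) \<in> path_edges P"
      by (rule edit_path_through[OF wf])
        (use that node[of i] child[of i] SV[of x y] leaves in \<open>auto simp: L_def\<close>)
    then have "(x, y) \<in> X" using edge[OF that(2)] unfolding X_def by blast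
    then show ?thesis unfolding D_def by force
  qed
  have card_edges: "card (path_edges Q) \<le> m"
    using card_length[of "zip Q (tl Q)"] lenQ unfolding path_edges_def by simp
  obtain x y P where P: "edit_path T S (x, y) P" "sublist Q P" and ne: "path_edges Q \<noteq> {}"
    using sparse unfolding is_sparse_path_def by fast
  have "(x, y) \<in> X"
    using P path_edges_sublist[OF P(2)] ne unfolding X_def by blast
  \<comment> \<open>The edit path that contains \<open>Q\<close> is itself counted by
    \<open>t\<close>.\<close>
  then have tpos: "1 \<le> t"
    using finX unfolding t_def by (metis One_nat_def Suc_leI card_gt_0_iff empty_iff)
  have long: "51 * t \<le> m"
  proof -
    have "real t \<le> real (card (path_edges Q)) / 51"
      using sparse unfolding is_sparse_path_def t_def X_def by simp
    then have "51 * t \<le> card (path_edges Q)" by (simp add: pos_le_divide_eq flip: of_nat_le_iff)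
    then show ?thesis using card_edges by linarith
  qed
  have edited: "\<exists>x\<in>L m. \<exists>y\<in>V. y \<notin> L 1 \<and> {x, y} \<in> S"
  proof -
    have e: "{x, y} \<in> S" "descending_path T P" "is_lca T x y (hd P)" "last P = Leaf x"
      using P(1) unfolding edit_path_def by auto
    obtain ps ss where split: "P = ps @ Q @ ss" using P(2) unfolding sublist_def by blast
    have down: "w \<in> nodes u"
      if "successively (\<lambda>u w. w \<in> set (children u)) R" "w \<in> set R" "R \<noteq> []" "u = hd R"
      for u w and R :: "'a cotree list"
      using that
    proof (induction R arbitrary: u)
      case (Cons a R)
      show ?case
      proof (cases "w = a")
        case False
        then have R: "R \<noteq> []" "w \<in> set R" using Cons.prems by auto
        then have "successively (\<lambda>u w. w \<in> set (children u)) R" "hd R \<in> set (children a)"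
          using Cons.prems(1) by (auto simp: successively_Cons)
        then show ?thesis
          using Cons.IH[OF _ R(2,1) refl] nodes_trans child_in_nodes Cons.prems(4) by fastforce
      qed (use Cons.prems in auto)
    qed simp
    have succ: "successively (\<lambda>u w. w \<in> set (children u)) P"
      using e(2) unfolding descending_path_def by blast
    have succ2: "successively (\<lambda>u w. w \<in> set (children u)) (last Q # ss)"
    proof (cases ss)
      case (Cons a list)
      then show ?thesis using succ Q(1) unfolding split by (auto simp: successively_append_iff)
    qed simp
    have "Leaf x = last (last Q # ss)"
      using e(4) Q(1) unfolding split by (cases ss) auto
    then have "Leaf x \<in> set (last Q # ss)"
      using last_in_set[of "last Q # ss"] by simp
    then have "Leaf x \<in> nodes (last Q)"
      by (intro down[OF succ2]) simp_all
    then have xm: "x \<in> L m"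
      using leaves_nodes lenQ Q(1) unfolding L_def m_def by (fastforce simp: last_conv_nth)
    have hdP: "Q ! 0 \<in> nodes (hd P)"
      by (rule down[OF succ]) (use split Q(1) lenQ in auto)
    \<comment> \<open>The edit path starts in the least common ancestor of \<open>x\<close> and
      \<open>y\<close>, at or above \<open>Q ! 0\<close>. If \<open>y\<close> were below
      \<open>Q ! 1\<close>, as \<open>x\<close> is, this ancestor would have to lie in the subtree
      of \<open>Q ! 1\<close>.\<close>
    have "y \<notin> L 1"
    proof
      assume y: "y \<in> L 1"
      have m0: "0 < m" using long tpos by linarith
      have "x \<in> L 1"
      proof -
        have "Q ! m \<in> nodes (Q ! 1)"
        proof (rule down[of "tl Q"])
          show "successively (\<lambda>u w. w \<in> set (children u)) (tl Q)"
            using Q(1,3) by (cases Q) (auto simp: successively_Cons)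
          show "Q ! m \<in> set (tl Q)" "tl Q \<noteq> []" "Q ! 1 = hd (tl Q)"
            using lenQ m0 by (cases Q; cases "tl Q"; auto simp: nth_Cons split: nat.splits)+
        qed
        then show ?thesis using xm leaves_nodes unfolding L_def by blast
      qed
      then have "hd P \<in> nodes (Q ! 1)"
        using e(3) y node[of 1] m0 unfolding is_lca_def L_def by auto
      then have "Q ! 0 \<in> nodes (Q ! 1)" using hdP nodes_trans by blast
      then show False
        using size_nodes size_child[OF child[OF m0]] by fastforce
    qed
    then show ?thesis using xm SV[OF e(1)] e(1) by blast
  qed
  have "levels V E S D k t m L join"
  proof
    show "simple_graph V E" "1 \<le> t" "51 * t \<le> m" "\<exists>x\<in>L m. \<exists>y\<in>V. y \<notin> L 1 \<and> {x, y} \<in> S"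
      by fact+
    show "L i \<subseteq> V" if "i \<le> m" for i using Lv[OF that] .
    show "L (Suc i) \<subset> L i" if "i < m" for i
      using leaves_nodes[OF child_in_nodes[OF child[OF that]]]
        other_child[OF wf_cotree_nodes[OF wf node[of i]] child[OF that]] that
      unfolding L_def by auto
    show "join (Suc i) \<longleftrightarrow> \<not> join i" if "Suc i < m" for i
    proof -
      have "i < m" using that by simp
      then obtain l ts where 1: "Q ! i = Node l ts"
        using child[of i] by (cases "Q ! i") auto
      from that obtain l' us where 2: "Q ! Suc i = Node l' us"
        using child[of "Suc i"] by (cases "Q ! Suc i") auto
      have "Node l' us \<in> set ts" using child[of i] that 1 2 by simp
      moreover have "Node l ts \<in> nodes T" using node[of i] that 1 by simp
      ultimately have "l' \<noteq> l" using wf unfolding wf_cotree_def by blast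
      then show ?thesis using 1 2 unfolding join_def by (cases l; cases l') auto
    qed
    show "{x, y} \<in> sym_diff E S \<longleftrightarrow> join i"
      if "i < m" "x \<in> L (Suc i)" "y \<in> L i" "y \<notin> L (Suc i)" for i x y
    proof -
      have lca: "is_lca T x y (Q ! i)"
        by (rule is_lca_branch[OF wf]) (use that node[of i] child[of i] in \<open>auto simp: L_def\<close>)
      have "x \<in> V" "y \<in> V" "x \<noteq> y" using that Lv[of i] Lv[of "Suc i"] by auto
      then have "{x, y} \<in> sym_diff E S \<longleftrightarrow> (\<exists>ts. is_lca T x y (Node OPlus ts))" by (rule adj)
      also have "\<dots> \<longleftrightarrow> join i"
        unfolding join_def using lca is_lca_unique by metis
      finally show ?thesis .
    qed
    show "{x, y} \<in> sym_diff E S \<longleftrightarrow> {x', y} \<in> sym_diff E S"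
      if "i \<le> m" "x \<in> L i" "x' \<in> L i" "y \<in> V" "y \<notin> L i" for i x x' y
    proof -
      have *: "x \<in> V" "x' \<in> V" "x \<noteq> y" "x' \<noteq> y" using that Lv[of i] by auto
      have "is_lca T x y z \<longleftrightarrow> is_lca T x' y z" for z
        using is_lca_replace[OF wf node[OF that(1)]] that(2,3,5) unfolding L_def by blast
      then show ?thesis using adj * that(4) by presburger
    qed
    show "{x, y} \<in> D" if "{x, y} \<in> S" "1 \<le> i" "i \<le> m" "x \<in> L i" "y \<notin> L i" for x y i
      using touched[of x y "i - 1"] that by auto
    show "D \<subseteq> all_pairs V" using XS S by blast
    show "card D \<le> t" unfolding D_def t_def by (rule card_image_le[OF finX])
    show "k + 2 \<le> card (L m)"
    proof -
      have "Q ! m \<in> set Q" using lenQ by simp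
      then show ?thesis using Q(4) unfolding T'_nodes_def L_def by auto
    qed
  qed
  then show thesis by (rule that)
qed

section \<open>Nested modules from guessed vertices\<close>

text \<open>
  The vertices \<open>w j, \<dots>, w (j + 4)\<close> are meant to come from five consecutive levels, the first one being
  labelled \<open>OPlus\<close>. A vertex above all of them fails one of the first two conditions, a vertex of the
  \<open>i\<close>-th level (\<open>i = 0, 1, 2\<close>) fails the one that is decided by a later level.
\<close>

definition inside :: "('a \<Rightarrow> 'a \<Rightarrow> bool) \<Rightarrow> (nat \<Rightarrow> 'a) \<Rightarrow> nat \<Rightarrow> 'a \<Rightarrow> bool" where
  "inside r w j v \<longleftrightarrow> r v (w j) \<and> \<not> r v (w (j + 1)) \<and> r v (w (j + 2)) \<and>
    (\<not> r v (w (j + 3)) \<or> \<not> r v (w (j + 4)))"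

text \<open>The guess occupies the indices \<open>1\<close> to \<open>15\<close>, five for each of
  \<open>A\<close>, \<open>A \<union> B\<close> and \<open>A \<union> B \<union> C\<close>. Testing
  from the inside outwards gives disjoint parts even if a wrong guess describes sets that are not
  nested. The vertex \<open>w 15\<close>, meant to lie in \<open>A \<union> B \<union> C\<close>,
  separates \<open>K\<close> from \<open>I\<close>.\<close>

definition part :: "('a \<Rightarrow> 'a \<Rightarrow> bool) \<Rightarrow> (nat \<Rightarrow> 'a) \<Rightarrow> 'a \<Rightarrow> nat" where
  "part r w v = (if inside r w 1 v then 0 else if inside r w 6 v then 1
    else if inside r w 11 v then 2 else if r v (w 15) then 3 else 4)"

text \<open>
  Adjacency to the single vertex \<open>x\<close> predicts the adjacency of \<open>v\<close> to the whole module; for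
  a clean vertex \<open>x\<close> of the module only the edited pairs deviate from the prediction.
\<close>

definition crossings :: "'a set \<Rightarrow> ('a \<Rightarrow> 'a \<Rightarrow> bool) \<Rightarrow> (nat \<Rightarrow> 'a) \<Rightarrow> nat \<Rightarrow> 'a \<Rightarrow> nat" where
  "crossings V r w q x =
    (\<Sum>v\<in>V. if part r w v \<le> q then 0 else card {u \<in> V. part r w u \<le> q \<and> r u v \<noteq> r x v})"

text \<open>For \<open>q = 1\<close> and \<open>q = 2\<close> these are the attached sets of
  \<open>B\<close> and \<open>C\<close>; \<open>b\<close> selects between the versions with index
  \<open>\<oplus>\<close> and \<open>+\<close>.\<close>

definition conforming :: "'a set \<Rightarrow> ('a \<Rightarrow> 'a \<Rightarrow> bool) \<Rightarrow> (nat \<Rightarrow> 'a) \<Rightarrow> nat \<Rightarrow> bool \<Rightarrow> 'a set" where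
  "conforming V r w q b = {v \<in> V. part r w v = q \<and>
    (\<forall>u\<in>V. (part r w u < q \<longrightarrow> r v u = b) \<and> (part r w u = 3 \<longrightarrow> r v u) \<and> (part r w u = 4 \<longrightarrow> \<not> r v u))}"

text \<open>The vertices \<open>w 5\<close>, \<open>w 10\<close> and \<open>w 15\<close> come last
  in their groups of five. For the intended guess each is a clean vertex inside the set that its
  group describes, so it can predict the adjacencies of this set.\<close>

definition valid :: "'a set \<Rightarrow> ('a \<Rightarrow> 'a \<Rightarrow> bool) \<Rightarrow> nat \<Rightarrow> nat \<Rightarrow> (nat \<Rightarrow> 'a) \<Rightarrow> bool" where
  "valid V r k t w \<longleftrightarrow> 1 \<le> t \<and>
    crossings V r w 0 (w 5) \<le> t \<and> crossings V r w 1 (w 10) \<le> t \<and> crossings V r w 2 (w 15) \<le> t \<and>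
    k + t < card {v \<in> V. part r w v = 0} \<and>
    3 * t + 1 \<le> card (conforming V r w 1 True) \<and> 3 * t + 1 \<le> card (conforming V r w 1 False) \<and>
    3 * t + 1 \<le> card (conforming V r w 2 True) \<and> 3 * t + 1 \<le> card (conforming V r w 2 False) \<and>
    (\<exists>v\<in>V. part r w v = 3) \<and> (\<exists>v\<in>V. part r w v = 4) \<and>
    (\<exists>u\<in>V. \<exists>v\<in>V. part r w u = 0 \<and> (part r w v = 4 \<and> r u v \<or> part r w v = 3 \<and> \<not> r u v))"

text \<open>Toggling exactly the pairs that deviate from the prediction by \<open>x\<close> gives
  all vertices of the set the same neighbours outside, and \<open>crossings\<close> counts these
  pairs.\<close>

lemma is_t_module_crossings:
  assumes graph: "simple_graph V E"
    and count: "crossings V (\<lambda>x y. {x, y} \<in> E) w q x \<le> t"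
  shows "is_t_module V E t {v \<in> V. part (\<lambda>x y. {x, y} \<in> E) w v \<le> q}"
proof -
  let ?r = "\<lambda>x y. {x, y} \<in> E"
  define X where "X = {v \<in> V. part ?r w v \<le> q}"
  define B where "B v = {u \<in> X. ?r u v \<noteq> ?r x v}" for v
  define F where "F = (\<Union>v\<in>V - X. (\<lambda>u. {u, v}) ` B v)"
  have fin: "finite V" using graph unfolding simple_graph_def by blast
  have XV: "X \<subseteq> V" unfolding X_def by blast
  have BX: "B v \<subseteq> X" for v unfolding B_def by blast
  have "F \<subseteq> all_pairs V"
  proof
    fix e assume "e \<in> F"
    then obtain v where v: "v \<in> V - X" "e \<in> (\<lambda>u. {u, v}) ` B v"
      unfolding F_def by (rule UN_E)
    then obtain u where "u \<in> X" "e = {u, v}" using BX by (elim imageE) auto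
    with v have "e = {u, v}" "v \<in> V" "v \<notin> X" "u \<in> X" by simp_all
    moreover have "u \<in> V" "u \<noteq> v" using calculation XV by auto
    ultimately show "e \<in> all_pairs V" unfolding all_pairs_def by auto
  qed
  moreover have "card F \<le> t"
  proof -
    have "card F \<le> (\<Sum>v\<in>V - X. card ((\<lambda>u. {u, v}) ` B v))"
      unfolding F_def using fin by (intro card_UN_le) auto
    also have "\<dots> \<le> (\<Sum>v\<in>V - X. card (B v))"
      by (intro sum_mono card_image_le finite_subset[OF BX] finite_subset[OF XV fin])
    also have "\<dots> = (\<Sum>v\<in>V. if part ?r w v \<le> q then 0 else card (B v))"
      using fin by (intro sum.mono_neutral_cong_left) (auto simp: X_def)
    also have "\<dots> = crossings V ?r w q x"
      unfolding crossings_def B_def X_def by (intro sum.cong) (auto intro!: arg_cong[of _ _ card])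
    finally show ?thesis using count by linarith
  qed
  moreover have "is_module V (sym_diff E F) X"
  proof -
    have F_iff: "{u, v} \<in> F \<longleftrightarrow> u \<in> B v" if "u \<in> X" "v \<in> V - X" for u v
      using that BX unfolding F_def by (fastforce simp: doubleton_eq_iff)
    have "{u, v} \<in> sym_diff E F \<longleftrightarrow> ?r x v" if "u \<in> X" "v \<in> V - X" for u v
      using F_iff[OF that] that(1) unfolding B_def by blast
    then show ?thesis unfolding is_module_def using XV by blast
  qed
  ultimately show ?thesis unfolding is_t_module_def X_def by blast
qed

text \<open>Soundness for arbitrary guesses: the search may stop at a guess that has nothing to do
  with the cotree.\<close>

lemma valid_nested:
  assumes graph: "simple_graph V E" and valid: "valid V (\<lambda>x y. {x, y} \<in> E) k t w"
  defines "P \<equiv> \<lambda>j. {v \<in> V. part (\<lambda>x y. {x, y} \<in> E) w v = j}"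
  shows "is_nested_t_module V E k t (P 0) (P 1) (P 2) (P 3) (P 4)"
    and "nested_rule_applies E (P 0) (P 3) (P 4)"
proof -
  let ?r = "\<lambda>x y. {x, y} \<in> E"
  have fin: "finite V" using graph unfolding simple_graph_def by blast
  have part: "part ?r w v \<in> {0, 1, 2, 3, 4}" for v unfolding part_def by auto
  have P01: "P 0 \<union> P 1 = {v \<in> V. part ?r w v \<le> 1}" unfolding P_def by auto
  have P012: "P 0 \<union> P 1 \<union> P 2 = {v \<in> V. part ?r w v \<le> 2}" unfolding P_def by auto
  have mod: "is_t_module V E t (P 0)"
    using is_t_module_crossings[OF graph, of w 0 "w 5" t] valid unfolding valid_def P_def by simp
  have mod1: "is_t_module V E t (P 0 \<union> P 1)"
    using is_t_module_crossings[OF graph, of w 1 "w 10" t] valid unfolding P01 valid_def by blast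
  have mod2: "is_t_module V E t (P 0 \<union> P 1 \<union> P 2)"
    unfolding P012 using is_t_module_crossings[OF graph, of w 2 "w 15" t] valid unfolding valid_def by blast
  have att:
    "attached E (P 1) (P 0 \<union> P 3) (P 4) = conforming V ?r w 1 True"
    "attached E (P 1) (P 3) (P 0 \<union> P 4) = conforming V ?r w 1 False"
    "attached E (P 2) (P 0 \<union> P 1 \<union> P 3) (P 4) = conforming V ?r w 2 True"
    "attached E (P 2) (P 3) (P 0 \<union> P 1 \<union> P 4) = conforming V ?r w 2 False"
    unfolding attached_def conforming_def P_def by (auto simp: less_2_cases_iff)
  have cover: "P 0 \<union> P 1 \<union> P 2 \<union> P 3 \<union> P 4 = V"
    unfolding P_def using part by fastforce
  have dis: "P i \<inter> P j = {}" if "i \<noteq> j" for i j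
    using that unfolding P_def by blast
  have card: "k + t < card (P 0)"
    "3 * t + 1 \<le> card (conforming V ?r w 1 True)" "3 * t + 1 \<le> card (conforming V ?r w 1 False)"
    "3 * t + 1 \<le> card (conforming V ?r w 2 True)" "3 * t + 1 \<le> card (conforming V ?r w 2 False)"
    using valid unfolding valid_def P_def by simp_all
  have ne: "P j \<noteq> {}" if "j \<in> {0, 1, 2, 3, 4}" for j
  proof -
    have "conforming V ?r w 1 True \<noteq> {}" "conforming V ?r w 2 True \<noteq> {}"
      "P 0 \<noteq> {}" "P 3 \<noteq> {}" "P 4 \<noteq> {}"
      using card valid unfolding valid_def P_def by auto
    then show ?thesis using that unfolding conforming_def P_def by auto
  qed
  show "is_nested_t_module V E k t (P 0) (P 1) (P 2) (P 3) (P 4)"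
    unfolding is_nested_t_module_def att
    using cover ne mod mod1 mod2 dis card by simp
  show "nested_rule_applies E (P 0) (P 3) (P 4)"
    using valid unfolding valid_def nested_rule_applies_def P_def by fastforce
qed

context levels
begin

section \<open>Representatives of the levels\<close>

abbreviation adj :: "'a \<Rightarrow> 'a \<Rightarrow> bool" where
  "adj x y \<equiv> {x, y} \<in> E"

definition rep :: "nat \<Rightarrow> 'a" where
  "rep i = (SOME x. x \<in> L i \<and> x \<notin> L (Suc i))"

definition clean :: "nat \<Rightarrow> bool" where
  "clean i \<longleftrightarrow> rep i \<notin> \<Union>D"

lemma finite_V: "finite V"
  using graph unfolding simple_graph_def by blast

lemma rep: "i < m \<Longrightarrow> rep i \<in> L i \<and> rep i \<notin> L (Suc i)"
  unfolding rep_def using L_desc[of i] someI_ex[of "\<lambda>x. x \<in> L i \<and> x \<notin> L (Suc i)"] by blast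

lemma L_antimono: "i \<le> j \<Longrightarrow> j \<le> m \<Longrightarrow> L j \<subseteq> L i"
proof (induction j rule: nat_induct_at_least[of i])
  case (Suc j)
  then show ?case using L_desc[of j] by auto
qed simp

lemma rep_in: "i \<le> j \<Longrightarrow> j < m \<Longrightarrow> rep j \<in> L i"
  using rep L_antimono[of i j] by auto

lemma rep_in_V: "j < m \<Longrightarrow> rep j \<in> V"
  using rep_in[of 0 j] L_sub[of 0] by auto

lemma rep_notin: "j < i \<Longrightarrow> i \<le> m \<Longrightarrow> rep j \<notin> L i"
  using rep[of j] L_antimono[of "Suc j" i] by auto

lemma inj_rep: "inj_on rep {..<m}"
proof (rule linorder_inj_onI)
  fix i j assume "i < j" "i \<in> {..<m}" "j \<in> {..<m}"
  then show "rep i \<noteq> rep j" using rep[of j] rep_notin[of i j] by auto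
qed auto

lemma finite_D: "finite (\<Union>D)"
proof (rule finite_subset[OF _ finite_V])
  show "\<Union>D \<subseteq> V" using D_sub unfolding all_pairs_def by blast
qed

lemma card_Union_D: "card (\<Union>D) \<le> 2 * t"
proof -
  have "card e \<le> 2" if "e \<in> D" for e
    using that D_sub unfolding all_pairs_def by (auto simp: card_insert_if)
  then have "sum card D \<le> 2 * card D"
    using sum_bounded_above[of D card 2] by (simp add: mult.commute)
  then show ?thesis using card_Union_le_sum_card[of D] card_D by linarith
qed

lemma join_add_even: "i + 2 * j < m \<Longrightarrow> join (i + 2 * j) \<longleftrightarrow> join i"
proof (induction j)
  case (Suc j)
  then show ?case using join_alt[of "i + 2 * j"] join_alt[of "Suc (i + 2 * j)"] by simp
qed simp

text \<open>The pair leaves \<open>L (Suc i)\<close> or \<open>L i\<close>, so if it were edited, it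
  would belong to \<open>D\<close> and make \<open>rep i\<close> dirty. A vertex \<open>y\<close> of
  the same level is excluded because that pair crosses neither boundary.\<close>

lemma clean_adj:
  assumes "1 \<le> i" "i < m" "clean i" "y \<in> V" "y \<in> L (Suc i) \<or> y \<notin> L i"
  shows "adj (rep i) y \<longleftrightarrow> {rep i, y} \<in> sym_diff E S"
proof -
  have "{rep i, y} \<notin> S"
  proof
    assume S: "{rep i, y} \<in> S"
    have "{rep i, y} \<in> D"
      using assms(5)
    proof
      assume "y \<in> L (Suc i)"
      then show ?thesis
        using crossing[of y "rep i" "Suc i"] S rep[OF assms(2)] assms(2) by (simp add: insert_commute)
    qed (use crossing[OF S, of i] rep[OF assms(2)] assms in simp)
    then show False using assms(3) unfolding clean_def by blast
  qed
  then show ?thesis by blast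
qed

lemma clean_adj_below:
  assumes "1 \<le> i" "i < m" "clean i" "y \<in> L (Suc i)"
  shows "adj (rep i) y \<longleftrightarrow> join i"
proof -
  have "y \<in> V" using assms L_sub[of "Suc i"] by auto
  then show ?thesis
    using clean_adj[OF assms(1-3), of y] join_adj[OF assms(2,4), of "rep i"] rep[OF assms(2)] assms(4)
    unfolding insert_commute[of y] by blast
qed

lemma clean_adj_above:
  assumes "j < i" "1 \<le> i" "i < m" "clean i" "y \<in> L j" "y \<notin> L (Suc j)"
  shows "adj (rep i) y \<longleftrightarrow> join j"
proof -
  have "y \<in> V" using assms L_sub[of j] by auto
  moreover have "y \<notin> L i" using L_antimono[of "Suc j" i] assms by auto
  moreover have "rep i \<in> L (Suc j)" using rep_in[of "Suc j" i] assms by simp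
  ultimately show ?thesis
    using clean_adj[OF assms(2-4)] join_adj[of j "rep i" y] assms by simp
qed

section \<open>Windows of clean levels\<close>

definition clean_window :: "nat \<Rightarrow> bool" where
  "clean_window p \<longleftrightarrow> 1 \<le> p \<and> p + 4 < m \<and> join p \<and> (\<forall>e<5. clean (p + e))"

lemma clean_windowD:
  assumes "clean_window p" "e < 5"
  shows "1 \<le> p + e" "p + e < m" "clean (p + e)" "join (p + e) \<longleftrightarrow> even e"
proof -
  show *: "1 \<le> p + e" "p + e < m" "clean (p + e)"
    using assms unfolding clean_window_def by auto
  show "join (p + e) \<longleftrightarrow> even e"
  proof (cases "even e")
    case True
    then obtain j where "e = 2 * j" by blast
    then show ?thesis using join_add_even[of p j] * True assms(1) unfolding clean_window_def by simp
  next
    case False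
    then obtain j where "e = 2 * j + 1" by (rule oddE)
    then have j: "e = Suc (2 * j)" by simp
    then show ?thesis
      using join_add_even[of p j] * False assms(1) join_alt[of "p + 2 * j"]
      unfolding clean_window_def by simp
  qed
qed

text \<open>A vertex above the window sees \<open>rep p\<close> and \<open>rep (p + 1)\<close>
  alike, because \<open>L p\<close> is a module of \<open>H\<close>. A vertex of a window level sees
  every later representative according to the label of its own level, but its adjacency to the
  representative of its own level is unknown. Hence the disjunction: level \<open>p + 3\<close> is
  recognised by \<open>rep (p + 4)\<close>, deeper vertices by \<open>rep (p + 3)\<close>.\<close>

lemma inside_clean_window:
  assumes p: "clean_window p" and w: "\<And>e. e < 5 \<Longrightarrow> w (i + e) = rep (p + e)"
    and v: "v \<in> V"
  shows "inside adj w i v \<longleftrightarrow> v \<in> L (p + 3)"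
proof -
  note c = clean_windowD[OF p]
  have w': "w i = rep p" "w (i + 1) = rep (p + 1)" "w (i + 2) = rep (p + 2)"
    "w (i + 3) = rep (p + 3)" "w (i + 4) = rep (p + 4)"
    using w[of 0] w[of 1] w[of 2] w[of 3] w[of 4] by simp_all
  have below: "adj v (rep (p + e)) \<longleftrightarrow> even e" if "e < 5" "v \<in> L (Suc (p + e))" for e
    using clean_adj_below[OF c(1-3)] c(4) that by (simp add: insert_commute)
  have above: "adj v (rep (p + e)) \<longleftrightarrow> even e'"
    if "e < 5" "e' < e" "v \<in> L (p + e')" "v \<notin> L (Suc (p + e'))" for e e'
    using clean_adj_above[of "p + e'" "p + e" v] c(1-3)[of e] c(4)[of e'] that by (simp add: insert_commute)
  have desc: "v \<in> L (p + e) \<Longrightarrow> e' \<le> e \<Longrightarrow> e \<le> 5 \<Longrightarrow> v \<in> L (p + e')" for e e'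
    using L_antimono[of "p + e'" "p + e"] c(2)[of 4] by auto
  consider "v \<notin> L p" | "v \<in> L p" "v \<notin> L (p + 1)" | "v \<in> L (p + 1)" "v \<notin> L (p + 2)"
    | "v \<in> L (p + 2)" "v \<notin> L (p + 3)" | "v \<in> L (p + 3)" "v \<notin> L (p + 4)" | "v \<in> L (p + 4)"
    by blast
  then show ?thesis
  proof cases
    case 1
    have "adj v (rep p) \<longleftrightarrow> adj v (rep (p + 1))"
    proof -
      have "v \<notin> L (p + 1)" using 1 desc[of 1 0] by auto
      then have "adj (rep p) v \<longleftrightarrow> {rep p, v} \<in> sym_diff E S"
        "adj (rep (p + 1)) v \<longleftrightarrow> {rep (p + 1), v} \<in> sym_diff E S"
        using clean_adj[of p v] clean_adj[of "p + 1" v] c[of 0] c[of 1] v 1 by simp_all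
      moreover have "{rep p, v} \<in> sym_diff E S \<longleftrightarrow> {rep (p + 1), v} \<in> sym_diff E S"
        using L_module[of p "rep p" "rep (p + 1)" v] rep_in[of p p] rep_in[of p "p + 1"] c(2)[of 0] c(2)[of 1] v 1
        by simp
      ultimately show ?thesis by (simp add: insert_commute)
    qed
    moreover have "v \<notin> L (p + 3)" using 1 desc[of 3 0] by auto
    ultimately show ?thesis unfolding inside_def w' by blast
  next
    case 2
    then show ?thesis
      using above[of 1 0] desc[of 3 1] unfolding inside_def w' by auto
  next
    case 3
    then show ?thesis
      using above[of 2 1] desc[of 3 2] unfolding inside_def w' by auto
  next
    case 4
    then show ?thesis
      using above[of 3 2] above[of 4 2] unfolding inside_def w' by (auto simp: numeral_eq_Suc)
  next
    case 5
    have p4: "p + 4 = Suc (p + 3)" by simp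
    have "\<not> adj v (rep (p + 4))"
      using above[of 4 3] 5 unfolding p4[symmetric] by simp
    then show ?thesis
      using 5 below[of 0] below[of 1] below[of 2] desc[of 3 1] desc[of 3 2]
      unfolding inside_def w' by (simp add: numeral_eq_Suc)
  next
    case 6
    have p4: "p + 4 = Suc (p + 3)" by simp
    have "\<not> adj v (rep (p + 3))"
      using below[of 3] 6 unfolding p4[symmetric] by simp
    then show ?thesis
      using 6 below[of 0] below[of 1] below[of 2] desc[of 4 1] desc[of 4 2] desc[of 4 3]
      unfolding inside_def w' by (simp add: numeral_eq_Suc)
  qed
qed

text \<open>
  Among \<open>6 * t + 1\<close> disjoint blocks of six levels at most \<open>2 * t\<close> contain a dirty representative; of the
  remaining \<open>4 * t + 1\<close> blocks, three are pairwise at least \<open>2 * t\<close> blocks apart.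
\<close>

lemma clean_windows:
  obtains a b c where "clean_window a" "clean_window b" "clean_window c"
    "c + 12 * t \<le> b" "b + 12 * t \<le> a" "a + t + 5 \<le> m"
proof -
  \<comment> \<open>Labels alternate, so level \<open>1\<close> or level \<open>2\<close> is
    labelled \<open>OPlus\<close>. Level \<open>0\<close> is avoided, since \<open>Q\<close> has no
    edge above its first node. Blocks of even length then all start with the same label.\<close>
  obtain s where s: "1 \<le> s" "s \<le> 2" "join s"
    using join_alt[of 1] long t_pos by (cases "join 1") (auto simp: numeral_2_eq_2)
  define G where "G = {j. j \<le> 6 * t \<and> clean_window (s + 6 * j)}"
  have finG: "finite G" unfolding G_def by auto
  \<comment> \<open>The largest value is \<open>2 + 36 * t + t + 5\<close>, at most
    \<open>51 * t\<close> as \<open>1 \<le> t\<close>. The summand \<open>t\<close> makes the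
    innermost set large enough for \<open>card A > k + t\<close>.\<close>
  have bound: "s + 6 * j + t + 5 \<le> m" if "j \<le> 6 * t" for j
    using that s long t_pos by linarith
  have "card ({..6 * t} - G) \<le> card (\<Union>D)"
  proof -
    \<comment> \<open>Choosing a dirty level in each bad block is injective because the blocks are
      disjoint, so there are at most as many bad blocks as dirty vertices.\<close>
    have "\<exists>e<5. \<not> clean (s + 6 * j + e)" if "j \<in> {..6 * t} - G" for j
    proof -
      have "join (s + 6 * j)" using join_add_even[of s "3 * j"] bound[of j] s that by simp
      then show ?thesis using that bound[of j] s t_pos unfolding G_def clean_window_def by auto
    qed
    then obtain f where f: "\<And>j. j \<in> {..6 * t} - G \<Longrightarrow> f j < 5 \<and> \<not> clean (s + 6 * j + f j)"
      by metis
    show ?thesis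
    proof (rule card_inj_on_le)
      show "inj_on (\<lambda>j. rep (s + 6 * j + f j)) ({..6 * t} - G)"
      proof (rule inj_onI)
        fix i j assume i: "i \<in> {..6 * t} - G" and j: "j \<in> {..6 * t} - G"
          and eq: "rep (s + 6 * i + f i) = rep (s + 6 * j + f j)"
        have "s + 6 * i + f i = s + 6 * j + f j"
          using inj_onD[OF inj_rep eq] f[OF i] f[OF j] bound[of i] bound[of j] i j t_pos by simp
        then have "6 * i + f i = 6 * j + f j" by linarith
        moreover have "f i < 5" "f j < 5" using f[OF i] f[OF j] by auto
        ultimately show "i = j" by presburger
      qed
      show "(\<lambda>j. rep (s + 6 * j + f j)) ` ({..6 * t} - G) \<subseteq> \<Union>D"
        using f unfolding clean_def by blast
    qed (rule finite_D)
  qed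
  moreover have "card ({..6 * t} - G) = 6 * t + 1 - card G"
    using finG by (subst card_Diff_subset) (auto simp: G_def)
  ultimately have G: "4 * t + 1 \<le> card G" using card_Union_D by linarith
  then have ne: "G \<noteq> {}" by auto
  define x where "x = Min G"
  define z where "z = Max G"
  have xz: "x \<in> G" "z \<in> G" "\<And>j. j \<in> G \<Longrightarrow> x \<le> j \<and> j \<le> z"
    using finG ne unfolding x_def z_def by auto
  \<comment> \<open>The two intervals around the extremes hold at most \<open>4 * t\<close> numbers,
    too few for \<open>G\<close>; a block outside both is far from the first and from the last
    one.\<close>
  have "\<not> G \<subseteq> {x..<x + 2 * t} \<union> {z - 2 * t<..z}"
  proof
    assume "G \<subseteq> {x..<x + 2 * t} \<union> {z - 2 * t<..z}"
    then have "card G \<le> card {x..<x + 2 * t} + card {z - 2 * t<..z}"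
      by (meson card_Un_le card_mono finite_UnI finite_atLeastLessThan finite_greaterThanAtMost order_trans)
    then show False using G by simp
  qed
  then obtain y where y: "y \<in> G" "x + 2 * t \<le> y" "y + 2 * t \<le> z"
    using xz(3) by fastforce
  show thesis
    by (rule that[of "s + 6 * z" "s + 6 * y" "s + 6 * x"])
      (use xz(1,2) y bound[of z] in \<open>auto simp: G_def\<close>)
qed

section \<open>Counting pairs and conforming vertices\<close>

lemma card_L: "i \<le> m \<Longrightarrow> k + 2 + (m - i) \<le> card (L i)"
proof (induction "m - i" arbitrary: i)
  case 0
  then show ?case using large by simp
next
  case (Suc x)
  then have "card (L (Suc i)) < card (L i)"
    using finite_subset[OF L_sub finite_V] L_desc by (intro psubset_card_mono) auto
  moreover have "k + 2 + (m - Suc i) \<le> card (L (Suc i))"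
    by (rule Suc.hyps(1)) (use Suc in linarith)+
  ultimately show ?case using Suc.hyps(2) Suc.prems by linarith
qed

text \<open>The clean vertex \<open>rep (Suc c)\<close> sees the outside of \<open>L c\<close> as in
  \<open>H\<close>, where \<open>L c\<close> is a module. So \<open>u\<close> deviates from it only
  at edited pairs that cross \<open>L c\<close>, all of which lie in \<open>D\<close>.\<close>

lemma pairs_crossing:
  assumes c: "1 \<le> c" "Suc c < m" "clean (Suc c)"
  shows "(\<Sum>v\<in>V - L c. card {u \<in> L c. adj u v \<noteq> adj (rep (Suc c)) v}) \<le> t"
proof -
  let ?B = "\<lambda>v. {u \<in> L c. adj u v \<noteq> adj (rep (Suc c)) v}"
  have LV: "L c \<subseteq> V" using L_sub[of c] c by simp
  have finB: "finite (?B v)" for v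
    using finite_subset[OF LV finite_V] by simp
  have sub: "(\<lambda>(v, u). {u, v}) ` (SIGMA v:V - L c. ?B v) \<subseteq> D"
  proof clarify
    fix u v assume v: "v \<in> V" "v \<notin> L c" and u: "u \<in> L c" and ne: "adj u v \<noteq> adj (rep (Suc c)) v"
    have "v \<notin> L (Suc c)" using L_antimono[of c "Suc c"] v c by auto
    then have "adj (rep (Suc c)) v \<longleftrightarrow> {rep (Suc c), v} \<in> sym_diff E S"
      using clean_adj[of "Suc c" v] c v by simp
    also have "\<dots> \<longleftrightarrow> {u, v} \<in> sym_diff E S"
      using L_module[of c "rep (Suc c)" u v] rep_in[of c "Suc c"] c u v by simp
    finally have "{u, v} \<in> S" using ne by blast
    then show "{u, v} \<in> D" using crossing[of u v c] c u v by simp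
  qed
  have "(\<Sum>v\<in>V - L c. card (?B v)) = card (SIGMA v:V - L c. ?B v)"
    using finite_V finB by (simp add: card_SigmaI)
  also have "\<dots> \<le> card D"
  proof (rule card_inj_on_le[OF _ sub])
    show "inj_on (\<lambda>(v, u). {u, v}) (SIGMA v:V - L c. ?B v)"
      by (auto simp: inj_on_def doubleton_eq_iff)
    show "finite D" using finite_D finite_UnionD by blast
  qed
  finally show ?thesis using card_D by linarith
qed

text \<open>
  Of the levels with the required label, \<open>5 * t + 1\<close> are used and at most \<open>2 * t\<close> are dirty.
\<close>

lemma many_conforming:
  assumes outer: "1 \<le> outer" "outer \<le> lo" "Suc outer < m" "clean (Suc outer)"
    and lo: "\<not> join lo" "lo + 12 * t \<le> hi" "hi < m"
  shows "3 * t + 1 \<le> card {v \<in> L lo - L hi. (\<forall>u\<in>L hi. adj v u = b) \<and>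
    (\<forall>u\<in>V - L outer. adj v u = adj (rep (Suc outer)) u)}" (is "_ \<le> card ?C")
proof -
  \<comment> \<open>Starting at \<open>lo\<close> or one level later selects the label
    \<open>b\<close>, and steps of two keep it. The last level used, \<open>s + 10 * t\<close>, is
    at most \<open>lo + 10 * t + 1\<close>, hence above \<open>hi\<close>.\<close>
  define s where "s = (if b then Suc lo else lo)"
  have s: "lo \<le> s" "s \<le> Suc lo" "join s = b"
    using lo join_alt[of lo] t_pos unfolding s_def by auto
  define R where "R = (\<lambda>j. rep (s + 2 * j)) ` {..5 * t}"
  have bound: "s + 2 * j < hi" if "j \<le> 5 * t" for j
    using that s lo t_pos by linarith
  have "inj_on (\<lambda>j. rep (s + 2 * j)) {..5 * t}"
  proof (rule inj_onI)
    fix i j assume *: "i \<in> {..5 * t}" "j \<in> {..5 * t}" and eq: "rep (s + 2 * i) = rep (s + 2 * j)"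
    have "s + 2 * i = s + 2 * j"
      using inj_onD[OF inj_rep eq] bound[of i] bound[of j] * lo by simp
    then show "i = j" by simp
  qed
  then have "card R = 5 * t + 1" unfolding R_def by (simp add: card_image)
  then have "3 * t + 1 \<le> card (R - \<Union>D)"
    using diff_card_le_card_Diff[OF finite_D, of R] card_Union_D by linarith
  also have "\<dots> \<le> card ?C"
  proof (rule card_mono)
    show "finite ?C" using finite_subset[OF L_sub finite_V, of lo] lo by simp
    show "R - \<Union>D \<subseteq> ?C"
    proof
      fix v assume "v \<in> R - \<Union>D"
      then obtain j where j: "j \<le> 5 * t" "v = rep (s + 2 * j)" "clean (s + 2 * j)"
        unfolding R_def clean_def by blast
      let ?i = "s + 2 * j"
      have i: "lo \<le> ?i" "?i < hi" "1 \<le> ?i" "?i < m" using bound[OF j(1)] s outer lo by auto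
      have ji: "join ?i = b" using join_add_even[of s j] s i by simp
      have "adj v u = b" if "u \<in> L hi" for u
        using clean_adj_below[OF i(3,4) j(3), of u] L_antimono[of "Suc ?i" hi] that i lo ji j(2) by auto
      \<comment> \<open>This vertex separates \<open>K\<close> from \<open>I\<close>. Both it and
        \<open>v\<close> are clean members of \<open>L outer\<close>, a module of \<open>H\<close>,
        so they agree in \<open>G\<close> on everything outside.\<close>
      moreover have "adj v u = adj (rep (Suc outer)) u" if u: "u \<in> V - L outer" for u
      proof -
        have "u \<notin> L ?i" "u \<notin> L (Suc outer)"
          using L_antimono[of outer ?i] L_antimono[of outer "Suc outer"] u i outer by auto
        then have "adj v u \<longleftrightarrow> {v, u} \<in> sym_diff E S"
          "adj (rep (Suc outer)) u \<longleftrightarrow> {rep (Suc outer), u} \<in> sym_diff E S"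
          using clean_adj[OF i(3,4) j(3), of u] clean_adj[of "Suc outer" u] outer u j(2) by auto
        moreover have "{v, u} \<in> sym_diff E S \<longleftrightarrow> {rep (Suc outer), u} \<in> sym_diff E S"
          using L_module[of outer v "rep (Suc outer)" u] rep_in[of outer ?i] rep_in[of outer "Suc outer"] u i outer j(2)
          by simp
        ultimately show ?thesis by blast
      qed
      ultimately show "v \<in> ?C"
        using rep_in[of lo ?i] rep_notin[of ?i hi] i lo j(2) by auto
    qed
  qed
  finally show ?thesis .
qed

text \<open>The three sets are \<open>L (a + 3)\<close>, \<open>L (b + 3)\<close> and
  \<open>L (c + 3)\<close>, the last one being the largest. This is the completeness of the check:
  the search cannot come back empty.\<close>

lemma valid_windows:
  "\<exists>w. range w \<subseteq> V \<and> valid V adj k t w"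
proof -
  obtain a b c where win: "clean_window a" "clean_window b" "clean_window c"
    and le: "c + 12 * t \<le> b" "b + 12 * t \<le> a" "a + t + 5 \<le> m"
    by (rule clean_windows)
  \<comment> \<open>Indices start at \<open>1\<close>. Index \<open>0\<close> and those above
    \<open>15\<close> are never read and only get some value in \<open>V\<close>.\<close>
  define w where "w i = (if i \<le> 5 then rep (a + (i - 1)) else if i \<le> 10 then rep (b + (i - 6))
    else if i \<le> 15 then rep (c + (i - 11)) else rep c)" for i
  have pos: "1 \<le> c" using win(3) unfolding clean_window_def by blast
  have ranw: "range w \<subseteq> V"
    using rep_in_V le t_pos unfolding w_def by auto
  have ins: "inside adj w 1 v \<longleftrightarrow> v \<in> L (a + 3)" "inside adj w 6 v \<longleftrightarrow> v \<in> L (b + 3)"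
    "inside adj w 11 v \<longleftrightarrow> v \<in> L (c + 3)" if "v \<in> V" for v
    by (rule inside_clean_window[OF win(1) _ that] inside_clean_window[OF win(2) _ that]
        inside_clean_window[OF win(3) _ that]; simp add: w_def)+
  have w5: "w 5 = rep (Suc (a + 3))" "w 10 = rep (Suc (b + 3))" "w 15 = rep (Suc (c + 3))"
    unfolding w_def by (simp_all add: numeral_eq_Suc)
  have cl: "clean (Suc (a + 3))" "clean (Suc (b + 3))" "clean (Suc (c + 3))"
    using clean_windowD(3)[OF win(1), of 4] clean_windowD(3)[OF win(2), of 4]
      clean_windowD(3)[OF win(3), of 4] by (simp_all add: numeral_eq_Suc)
  have sub: "L (a + 3) \<subseteq> L (b + 3)" "L (b + 3) \<subseteq> L (c + 3)" "L (c + 3) \<subseteq> V"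
    using L_antimono[of "b + 3" "a + 3"] L_antimono[of "c + 3" "b + 3"] L_sub[of "c + 3"] le t_pos by auto
  let ?P = "part adj w"
  have P0: "?P v \<le> 0 \<longleftrightarrow> v \<in> L (a + 3)" "?P v \<le> 1 \<longleftrightarrow> v \<in> L (b + 3)" "?P v \<le> 2 \<longleftrightarrow> v \<in> L (c + 3)"
     if "v \<in> V" for v
    using ins[OF that] sub unfolding part_def by auto
  have P3: "?P v = 3 \<longleftrightarrow> v \<notin> L (c + 3) \<and> adj v (w 15)" "?P v = 4 \<longleftrightarrow> v \<notin> L (c + 3) \<and> \<not> adj v (w 15)"
     if "v \<in> V" for v
    using ins[OF that] sub unfolding part_def by auto
  have cross: "crossings V adj w q (rep (Suc (p + 3))) \<le> t"
    if "\<And>v. v \<in> V \<Longrightarrow> ?P v \<le> q \<longleftrightarrow> v \<in> L (p + 3)" "p + 5 \<le> m" "clean (Suc (p + 3))" for p q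
  proof -
    have LV: "L (p + 3) \<subseteq> V" using L_sub[of "p + 3"] that(2) by simp
    have "crossings V adj w q (rep (Suc (p + 3))) =
      (\<Sum>v\<in>V - L (p + 3). card {u \<in> L (p + 3). adj u v \<noteq> adj (rep (Suc (p + 3))) v})"
      unfolding crossings_def using finite_V LV that(1)
      by (intro sum.mono_neutral_cong_right) (auto intro!: arg_cong[of _ _ card])
    then show ?thesis using pairs_crossing[of "p + 3"] that by simp
  qed
  have conf: "3 * t + 1 \<le> card (conforming V adj w q x)"
    if P: "\<And>v. v \<in> V \<Longrightarrow> ?P v \<le> q \<longleftrightarrow> v \<in> L (lo + 3)" "\<And>v. v \<in> V \<Longrightarrow> ?P v < q \<longleftrightarrow> v \<in> L (hi + 3)"
      and lohi: "c \<le> lo" "lo + 12 * t \<le> hi" "hi \<le> a" "clean_window lo" for q lo hi x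
  proof -
    have "\<not> join (lo + 3)" using clean_windowD(4)[OF lohi(4), of 3] by simp
    then have "3 * t + 1 \<le> card {v \<in> L (lo + 3) - L (hi + 3). (\<forall>u\<in>L (hi + 3). adj v u = x) \<and>
      (\<forall>u\<in>V - L (c + 3). adj v u = adj (rep (Suc (c + 3))) u)}"
      using lohi le t_pos cl by (intro many_conforming) auto
    also have "\<dots> \<le> card (conforming V adj w q x)"
    proof (rule card_mono)
      show "finite (conforming V adj w q x)" unfolding conforming_def using finite_V by simp
      have LV: "L (lo + 3) \<subseteq> V" using L_sub[of "lo + 3"] lohi le by simp
      show "{v \<in> L (lo + 3) - L (hi + 3). (\<forall>u\<in>L (hi + 3). adj v u = x) \<and>
        (\<forall>u\<in>V - L (c + 3). adj v u = adj (rep (Suc (c + 3))) u)} \<subseteq> conforming V adj w q x"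
      proof
        fix v assume v: "v \<in> {v \<in> L (lo + 3) - L (hi + 3). (\<forall>u\<in>L (hi + 3). adj v u = x) \<and>
          (\<forall>u\<in>V - L (c + 3). adj v u = adj (rep (Suc (c + 3))) u)}"
        then have vV: "v \<in> V" using LV by blast
        have "?P v = q" using P[OF vV] v by auto
        moreover have "?P u < q \<longrightarrow> adj v u = x" "?P u = 3 \<longrightarrow> adj v u" "?P u = 4 \<longrightarrow> \<not> adj v u"
          if u: "u \<in> V" for u
          using P(2)[OF u] P3[OF u] v u unfolding w5 by (auto simp: insert_commute)
        ultimately show "v \<in> conforming V adj w q x"
          using vV unfolding conforming_def by blast
      qed
    qed
    finally show ?thesis .
  qed
  have cardA: "k + t < card {v \<in> V. ?P v = 0}"
  proof -
    have "{v \<in> V. ?P v = 0} = L (a + 3)" using P0(1) sub by auto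
    then show ?thesis using card_L[of "a + 3"] le by simp
  qed
  \<comment> \<open>The levels \<open>c\<close> and \<open>c + 1\<close> lie outside
    \<open>L (c + 3)\<close> and have opposite labels; their representatives show that
    \<open>K\<close> and \<open>I\<close> are not empty.\<close>
  have outside: "adj (w 15) (rep (c + e)) \<longleftrightarrow> even e" "rep (c + e) \<notin> L (c + 3)" "rep (c + e) \<in> V" if "e < 2" for e
  proof -
    have "adj (rep (c + 4)) (rep (c + e)) \<longleftrightarrow> join (c + e)"
      using clean_adj_above[of "c + e" "c + 4" "rep (c + e)"] clean_windowD[OF win(3), of 4]
        rep[of "c + e"] that by auto
    then show "adj (w 15) (rep (c + e)) \<longleftrightarrow> even e"
      using clean_windowD(4)[OF win(3), of e] that unfolding w_def by simp
    show "rep (c + e) \<notin> L (c + 3)" using rep_notin[of "c + e" "c + 3"] that le t_pos by simp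
    show "rep (c + e) \<in> V" using rep_in_V[of "c + e"] that le t_pos by simp
  qed
  have K: "\<exists>v\<in>V. ?P v = 3"
    using outside[of 0] P3(1)[of "rep c"] by (auto simp: insert_commute)
  have I: "\<exists>v\<in>V. ?P v = 4"
    using outside[of 1] P3(2)[of "rep (Suc c)"] by (auto simp: insert_commute)
  obtain x y where xy: "x \<in> L m" "y \<in> V" "y \<notin> L 1" "{x, y} \<in> S"
    using edited by blast
  have x: "x \<in> L (a + 3)" "x \<in> L (c + 3)" "x \<in> V"
    using L_antimono[of "a + 3" m] sub le xy(1) by auto
  have y: "y \<notin> L (c + 3)" "y \<notin> L (Suc (c + 3))"
    using L_antimono[of 1 "c + 3"] L_antimono[of 1 "Suc (c + 3)"] le t_pos xy(3) by auto
  \<comment> \<open>In \<open>H\<close> the vertices \<open>x\<close> and \<open>w 15\<close> agree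
    on \<open>y\<close>; in \<open>G\<close> the edited pair is flipped for \<open>x\<close> but not
    for the clean \<open>w 15\<close>. So the part of \<open>y\<close>, which is decided by
    \<open>w 15\<close>, is the wrong one for \<open>x\<close>.\<close>
  have "adj (w 15) y \<longleftrightarrow> {w 15, y} \<in> sym_diff E S"
    using clean_adj[of "Suc (c + 3)" y] cl y xy(2) le t_pos unfolding w5 by simp
  also have "\<dots> \<longleftrightarrow> {x, y} \<in> sym_diff E S"
    using L_module[of "c + 3" "w 15" x y] rep_in[of "c + 3" "Suc (c + 3)"] x y xy(2) le t_pos
    unfolding w5 by simp
  also have "\<dots> \<longleftrightarrow> \<not> adj x y" using xy(4) by blast
  finally have wy: "adj (w 15) y \<longleftrightarrow> \<not> adj x y" .
  have "?P y = 4 \<and> adj x y \<or> ?P y = 3 \<and> \<not> adj x y"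
    using P3[OF xy(2)] y(1) wy by (auto simp: insert_commute)
  moreover have "?P x = 0" using P0(1)[OF x(3)] x(1) by simp
  ultimately have rule: "\<exists>u\<in>V. \<exists>v\<in>V. ?P u = 0 \<and> (?P v = 4 \<and> adj u v \<or> ?P v = 3 \<and> \<not> adj u v)"
    using x(3) xy(2) by blast
  have lt: "?P v < 1 \<longleftrightarrow> v \<in> L (a + 3)" "?P v < 2 \<longleftrightarrow> v \<in> L (b + 3)" if "v \<in> V" for v
    using P0[OF that] by linarith+
  have "valid V adj k t w"
    unfolding valid_def
    using t_pos cross[OF P0(1) _ cl(1)] cross[OF P0(2) _ cl(2)] cross[OF P0(3) _ cl(3)] cardA
      conf[OF P0(2) lt(1), of True] conf[OF P0(2) lt(1), of False]
      conf[OF P0(3) lt(2), of True] conf[OF P0(3) lt(2), of False] K I rule le win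
    unfolding w5 by simp
  then show ?thesis using ranw by blast
qed

end

section \<open>Search for a nested module\<close>

lemma accum_False: "accum False f n = (\<Sum>i<n. f i)"
  by (induction n) auto

lemma accum_True: "accum True f n = (if \<exists>i<n. f i \<noteq> 0 then f (LEAST i. f i \<noteq> 0) else 0)"
proof (induction n)
  case (Suc n)
  show ?case
  proof (cases "\<exists>i<n. f i \<noteq> 0")
    case True
    then obtain i where "i < n" "f i \<noteq> 0" by blast
    then have "f (LEAST i. f i \<noteq> 0) \<noteq> 0" by (intro LeastI)
    moreover have "\<exists>i<Suc n. f i \<noteq> 0" using True less_Suc_eq by blast
    ultimately show ?thesis using Suc True by simp
  next
    case False
    then have "(LEAST i. f i \<noteq> 0) = n" if "f n \<noteq> 0"
      using that by (intro Least_equality) (auto simp: not_less[symmetric])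
    then show ?thesis using Suc False by (auto simp: less_Suc_eq simp del: neq0_conv)
  qed
qed simp

text \<open>The lexicographically first hit, which is the valuation at which nested loops of the
  kind \<open>Loop True\<close> take their value.\<close>

fun search :: "nat \<Rightarrow> ((nat \<Rightarrow> nat) \<Rightarrow> bool) \<Rightarrow> nat list \<Rightarrow> (nat \<Rightarrow> nat) \<Rightarrow> (nat \<Rightarrow> nat) option" where
  "search n P [] \<rho> = (if P \<rho> then Some \<rho> else None)"
| "search n P (v # vs) \<rho> = (if \<exists>i<n. search n P vs (\<rho>(v := i)) \<noteq> None
    then search n P vs (\<rho>(v := LEAST i. search n P vs (\<rho>(v := i)) \<noteq> None)) else None)"

lemma search_SomeD:
  "search n P vs \<rho> = Some \<tau> \<Longrightarrow> P \<tau>"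
  "search n P vs \<rho> = Some \<tau> \<Longrightarrow> x \<notin> set vs \<Longrightarrow> \<tau> x = \<rho> x"
proof (induction vs arbitrary: \<rho>)
  case Nil
  {
    case 1 then show ?case by (simp split: if_splits)
  next
    case 2 then show ?case by (simp split: if_splits)
  }
next
  case (Cons v vs)
  {
    case 1 then show ?case using Cons(1) by (auto split: if_splits)
  next
    case 2
    define \<rho>' where "\<rho>' = \<rho>(v := LEAST i. search n P vs (\<rho>(v := i)) \<noteq> None)"
    have "search n P vs \<rho>' = Some \<tau>" "x \<noteq> v" "x \<notin> set vs"
      using 2 unfolding \<rho>'_def by (auto simp del: not_None_eq split: if_splits)
    then have "\<tau> x = \<rho>' x" using Cons(2) by blast
    then show ?case using \<open>x \<noteq> v\<close> unfolding \<rho>'_def by simp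
  }
qed

lemma search_complete:
  assumes "P \<tau>" "\<And>x. x \<notin> set vs \<Longrightarrow> \<tau> x = \<rho> x" "\<And>x. x \<in> set vs \<Longrightarrow> \<tau> x < n"
  shows "search n P vs \<rho> \<noteq> None"
  using assms
proof (induction vs arbitrary: \<rho>)
  case Nil
  then have "\<tau> = \<rho>" by auto
  then show ?case using Nil by simp
next
  case (Cons v vs)
  have "search n P vs (\<rho>(v := \<tau> v)) \<noteq> None"
    by (rule Cons.IH) (use Cons.prems in auto)
  then show ?case
    using Cons.prems(3)[of v] LeastI[of "\<lambda>i. search n P vs (\<rho>(v := i)) \<noteq> None" "\<tau> v"] by auto
qed

text \<open>A variable that is neither searched nor read by \<open>P\<close> does not influence the
  hit. This makes the separate searches for the output cells consistent with each other.\<close>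

lemma search_upd:
  assumes "x \<notin> set vs" "\<And>\<rho> a. P (\<rho>(x := a)) \<longleftrightarrow> P \<rho>"
  shows "search n P vs (\<rho>(x := a)) = map_option (\<lambda>\<tau>. \<tau>(x := a)) (search n P vs \<rho>)"
  using assms(1)
proof (induction vs arbitrary: \<rho>)
  case (Cons v vs)
  have "search n P vs (\<rho>(x := a, v := i)) = map_option (\<lambda>\<tau>. \<tau>(x := a)) (search n P vs (\<rho>(v := i)))" for i
  proof -
    have "\<rho>(x := a, v := i) = \<rho>(v := i, x := a)"
      using Cons.prems by (intro fun_upd_twist) auto
    then show ?thesis using Cons.IH[of "\<rho>(v := i)"] Cons.prems by (simp del: fun_upd_apply)
  qed
  then show ?case
    unfolding search.simps(2) option.map_disc_iff
    by (cases "\<exists>i<n. search n P vs (\<rho>(v := i)) \<noteq> None")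
      (simp_all only: option.map_disc_iff if_True if_False option.map)
qed (simp add: assms(2))

definition find_first :: "nat list \<Rightarrow> expr \<Rightarrow> expr \<Rightarrow> expr" where
  "find_first vs c e = foldr (Loop True) vs (Cond c e (Num 0))"

text \<open>The loops recognise a hit by a nonzero value, so \<open>e\<close> must not vanish at
  one; otherwise the search would go on past it.\<close>

lemma eval_find_first:
  assumes "\<And>\<rho>. P \<rho> \<Longrightarrow> eval n k r e \<rho> \<noteq> 0" "\<And>\<rho>. P \<rho> \<longleftrightarrow> eval n k r c \<rho> \<noteq> 0"
  shows "eval n k r (find_first vs c e) \<rho> =
    (case search n P vs \<rho> of None \<Rightarrow> 0 | Some \<tau> \<Rightarrow> eval n k r e \<tau>)"
proof (induction vs arbitrary: \<rho>)
  case Nil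
  then show ?case using assms(2) by (simp add: find_first_def)
next
  case (Cons v vs)
  define f where "f i = eval n k r (find_first vs c e) (\<rho>(v := i))" for i
  have f: "f i = (case search n P vs (\<rho>(v := i)) of None \<Rightarrow> 0 | Some \<tau> \<Rightarrow> eval n k r e \<tau>)" for i
    unfolding f_def by (rule Cons)
  have iff: "f i \<noteq> 0 \<longleftrightarrow> search n P vs (\<rho>(v := i)) \<noteq> None" for i
    using assms(1)[OF search_SomeD(1)] by (cases "search n P vs (\<rho>(v := i))") (auto simp: f)
  have "eval n k r (find_first (v # vs) c e) \<rho> = accum True f n"
    unfolding find_first_def f_def by simp
  then have "eval n k r (find_first (v # vs) c e) \<rho> =
    (if \<exists>i<n. search n P vs (\<rho>(v := i)) \<noteq> None
     then f (LEAST i. search n P vs (\<rho>(v := i)) \<noteq> None) else 0)"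
    unfolding accum_True iff .
  then show ?case
    unfolding f search.simps(2)
    by (cases "\<exists>i<n. search n P vs (\<rho>(v := i)) \<noteq> None") (simp_all only: if_True if_False option.case)
qed

section \<open>The check as an expression\<close>

definition holds :: "nat \<Rightarrow> nat \<Rightarrow> (nat \<Rightarrow> nat \<Rightarrow> bool) \<Rightarrow> expr \<Rightarrow> (nat \<Rightarrow> nat) \<Rightarrow> bool" where
  "holds n k r a \<rho> \<longleftrightarrow> eval n k r a \<rho> \<noteq> 0"

lemma eval_Cond:
  "eval n k r (Cond c a b) \<rho> = (if holds n k r c \<rho> then eval n k r a \<rho> else eval n k r b \<rho>)"
  unfolding holds_def by simp

definition Neg :: "expr \<Rightarrow> expr" where
  "Neg a = Cond a (Num 0) (Num 1)"

definition Conj :: "expr \<Rightarrow> expr \<Rightarrow> expr" where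
  "Conj a b = Cond a b (Num 0)"

definition Imp :: "expr \<Rightarrow> expr \<Rightarrow> expr" where
  "Imp a b = Cond a b (Num 1)"

definition Disj :: "expr \<Rightarrow> expr \<Rightarrow> expr" where
  "Disj a b = Cond a (Num 1) b"

definition Differ :: "expr \<Rightarrow> expr \<Rightarrow> expr" where
  "Differ a b = Cond a (Neg b) b"

definition Less :: "expr \<Rightarrow> expr \<Rightarrow> expr" where
  "Less a b = Sub_expr b a"

definition Le :: "expr \<Rightarrow> expr \<Rightarrow> expr" where
  "Le a b = Neg (Less b a)"

definition Eq :: "expr \<Rightarrow> expr \<Rightarrow> expr" where
  "Eq a b = Conj (Le a b) (Le b a)"

lemma holds_simps:
  "holds n k r (Adj u v) \<rho> \<longleftrightarrow> r (\<rho> u) (\<rho> v)"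
  "holds n k r (Neg a) \<rho> \<longleftrightarrow> \<not> holds n k r a \<rho>"
  "holds n k r (Conj a b) \<rho> \<longleftrightarrow> holds n k r a \<rho> \<and> holds n k r b \<rho>"
  "holds n k r (Imp a b) \<rho> \<longleftrightarrow> (holds n k r a \<rho> \<longrightarrow> holds n k r b \<rho>)"
  "holds n k r (Disj a b) \<rho> \<longleftrightarrow> holds n k r a \<rho> \<or> holds n k r b \<rho>"
  "holds n k r (Differ a b) \<rho> \<longleftrightarrow> holds n k r a \<rho> \<noteq> holds n k r b \<rho>"
  "holds n k r (Less a b) \<rho> \<longleftrightarrow> eval n k r a \<rho> < eval n k r b \<rho>"
  "holds n k r (Le a b) \<rho> \<longleftrightarrow> eval n k r a \<rho> \<le> eval n k r b \<rho>"
  "holds n k r (Eq a b) \<rho> \<longleftrightarrow> eval n k r a \<rho> = eval n k r b \<rho>"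
  unfolding holds_def Neg_def Conj_def Imp_def Disj_def Differ_def Less_def Le_def Eq_def by auto

text \<open>As tests succeed on nonzero values, \<open>Count\<close> doubles as the existential
  quantifier.\<close>

definition Count :: "nat \<Rightarrow> expr \<Rightarrow> expr" where
  "Count v a = Loop False v (Cond a (Num 1) (Num 0))"

definition Forall :: "nat \<Rightarrow> expr \<Rightarrow> expr" where
  "Forall v a = Neg (Count v (Neg a))"

lemma eval_Count: "eval n k r (Count v a) \<rho> = card {i \<in> {..<n}. holds n k r a (\<rho>(v := i))}"
proof -
  have "eval n k r (Count v a) \<rho> = (\<Sum>i<n. if holds n k r a (\<rho>(v := i)) then 1 else 0)"
    unfolding Count_def eval.simps(8) accum_False eval_Cond eval.simps(1) ..
  also have "\<dots> = card {i \<in> {..<n}. holds n k r a (\<rho>(v := i))}"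
    by (subst sum.inter_filter[symmetric]) auto
  finally show ?thesis .
qed

lemma holds_Count: "holds n k r (Count v a) \<rho> \<longleftrightarrow> (\<exists>i\<in>{..<n}. holds n k r a (\<rho>(v := i)))"
  unfolding holds_def[of n k r "Count v a"] eval_Count by (auto simp: card_eq_0_iff)

lemma holds_Forall: "holds n k r (Forall v a) \<rho> \<longleftrightarrow> (\<forall>i\<in>{..<n}. holds n k r a (\<rho>(v := i)))"
  unfolding Forall_def holds_simps holds_Count by blast

definition Inside :: "nat \<Rightarrow> nat \<Rightarrow> expr" where
  "Inside j v = Conj (Adj v j) (Conj (Neg (Adj v (j + 1))) (Conj (Adj v (j + 2))
    (Disj (Neg (Adj v (j + 3))) (Neg (Adj v (j + 4))))))"

definition Part :: "nat \<Rightarrow> expr" where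
  "Part v = Cond (Inside 1 v) (Num 0) (Cond (Inside 6 v) (Num 1)
    (Cond (Inside 11 v) (Num 2) (Cond (Adj v 15) (Num 3) (Num 4))))"

lemma eval_Part: "eval n k r (Part v) \<rho> = part r \<rho> (\<rho> v)"
  unfolding Part_def part_def eval_Cond Inside_def inside_def holds_simps eval.simps(1) ..

definition Crossings :: "nat \<Rightarrow> nat \<Rightarrow> expr" where
  "Crossings q x = Loop False 16 (Cond (Le (Part 16) (Num q)) (Num 0)
    (Count 17 (Conj (Le (Part 17) (Num q)) (Differ (Adj 17 16) (Adj x 16)))))"

definition Conforming :: "nat \<Rightarrow> bool \<Rightarrow> expr" where
  "Conforming q b = Count 16 (Conj (Eq (Part 16) (Num q)) (Forall 17
    (Conj (Imp (Less (Part 17) (Num q)) (if b then Adj 16 17 else Neg (Adj 16 17)))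
    (Conj (Imp (Eq (Part 17) (Num 3)) (Adj 16 17))
      (Imp (Eq (Part 17) (Num 4)) (Neg (Adj 16 17)))))))"

text \<open>
  Variable \<open>0\<close> holds \<open>t\<close>, variables \<open>1\<close> to \<open>15\<close> the guessed vertices.
\<close>

definition Valid :: expr where
  "Valid =
    (let t = Var 0; s = Add_expr t (Add_expr t (Add_expr t (Num 1))) in
    Conj (Le (Num 1) t)
    (Conj (Le (Crossings 0 5) t)
    (Conj (Le (Crossings 1 10) t)
    (Conj (Le (Crossings 2 15) t)
    (Conj (Less (Add_expr Param t) (Count 16 (Eq (Part 16) (Num 0))))
    (Conj (Le s (Conforming 1 True))
    (Conj (Le s (Conforming 1 False))
    (Conj (Le s (Conforming 2 True))
    (Conj (Le s (Conforming 2 False))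
    (Conj (Count 16 (Eq (Part 16) (Num 3)))
    (Conj (Count 16 (Eq (Part 16) (Num 4)))
    (Count 16 (Count 17 (Conj (Eq (Part 16) (Num 0))
      (Disj (Conj (Eq (Part 17) (Num 4)) (Adj 16 17))
        (Conj (Eq (Part 17) (Num 3)) (Neg (Adj 16 17))))))))))))))))))"

text \<open>Only the indices \<open>1\<close> to \<open>15\<close> are read, so \<open>0\<close> is
  free for \<open>t\<close>, \<open>16\<close> and \<open>17\<close> for bound variables and
  \<open>18\<close> for the vertex whose part is printed.\<close>

lemma part_cong:
  assumes "\<And>j. 1 \<le> j \<Longrightarrow> j \<le> 15 \<Longrightarrow> w j = w' j"
  shows "part r w = part r w'"
  using assms unfolding part_def inside_def by (simp add: fun_eq_iff)

lemma valid_cong: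
  assumes "\<And>j. 1 \<le> j \<Longrightarrow> j \<le> 15 \<Longrightarrow> w j = w' j"
  shows "valid V r k t w \<longleftrightarrow> valid V r k t w'"
proof -
  have "part r w = part r w'"
    by (rule part_cong) (rule assms)
  moreover have "w 5 = w' 5" "w 10 = w' 10" "w 15 = w' 15"
    by (rule assms; simp)+
  ultimately show ?thesis
    unfolding valid_def crossings_def conforming_def by presburger
qed

lemma part_upd [simp]: "15 < v \<Longrightarrow> part r (w(v := a)) = part r w"
  by (rule part_cong) auto

lemma eval_Crossings:
  assumes "x \<le> 15"
  shows "eval n k r (Crossings q x) \<rho> = crossings {..<n} r \<rho> q (\<rho> x)"
proof -
  have "x \<noteq> 16" "x \<noteq> 17" using assms by auto
  then show ?thesis
    unfolding Crossings_def crossings_def eval.simps(8) accum_False eval_Cond eval_Count holds_simps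
      eval_Part
    by (simp cong: if_cong)
qed

lemma eval_Conforming: "eval n k r (Conforming q b) \<rho> = card (conforming {..<n} r \<rho> q b)"
  unfolding Conforming_def conforming_def eval_Count holds_simps holds_Forall eval_Part
  by (cases b) (simp_all add: holds_simps)

lemma holds_Valid: "holds n k r Valid \<rho> \<longleftrightarrow> valid {..<n} r k (\<rho> 0) \<rho>"
proof -
  have s: "\<rho> 0 + (\<rho> 0 + (\<rho> 0 + 1)) = 3 * \<rho> 0 + 1" by simp
  show ?thesis
    unfolding Valid_def valid_def Let_def holds_simps holds_Count eval_Count eval_Conforming eval_Part
      eval.simps(1-3,5) s
    by (simp add: eval_Crossings)
qed

text \<open>The machine works with vertex numbers. The check consists of counts, sums and bounded
  quantifiers, all of which are carried over by the bijection from positions to vertices.\<close>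

lemma valid_nth:
  assumes "distinct vs"
  shows "valid {..<length vs} (\<lambda>i j. r (vs ! i) (vs ! j)) k t w \<longleftrightarrow> valid (set vs) r k t (\<lambda>j. vs ! w j)"
proof -
  have bij: "bij_betw ((!) vs) {..<length vs} (set vs)"
    using assms by (rule bij_betw_nth) auto
  have img: "set vs = (!) vs ` {..<length vs}"
    using bij unfolding bij_betw_def by simp
  have card: "card {x \<in> set vs. Q x} = card {i \<in> {..<length vs}. Q (vs ! i)}" for Q
  proof (rule bij_betw_same_card[symmetric])
    show "bij_betw ((!) vs) {i \<in> {..<length vs}. Q (vs ! i)} {x \<in> set vs. Q x}"
      using bij unfolding bij_betw_def by (auto simp: inj_on_def)
  qed
  have sum: "(\<Sum>x\<in>set vs. f x) = (\<Sum>i<length vs. f (vs ! i))" for f :: "'a \<Rightarrow> nat"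
    by (rule sum.reindex_bij_betw[OF bij, symmetric])
  have ball: "(\<forall>x\<in>set vs. Q x) \<longleftrightarrow> (\<forall>i\<in>{..<length vs}. Q (vs ! i))" for Q
    unfolding img by blast
  have bex: "(\<exists>x\<in>set vs. Q x) \<longleftrightarrow> (\<exists>i\<in>{..<length vs}. Q (vs ! i))" for Q
    unfolding img by blast
  have part: "part (\<lambda>i j. r (vs ! i) (vs ! j)) w i = part r (\<lambda>j. vs ! w j) (vs ! i)" for i
    unfolding part_def inside_def by simp
  show ?thesis
    unfolding valid_def crossings_def conforming_def card sum ball bex part ..
qed

section \<open>The search program\<close>

definition search_vars :: "nat list" where
  "search_vars = [0..<16]"

lemma graph_input_cells:
  assumes graph: "simple_graph V E" and n: "length vs = n" "2 \<le> n"
  shows "graph_input vs E k 0 = n" "graph_input vs E k 1 = k" "graph_input vs E k 2 = 0"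
    "graph_input vs E k (n + 3) = 0"
    "i < n \<Longrightarrow> j < i \<Longrightarrow> graph_input vs E k (2 + (i * n + j)) = of_bool ({vs ! i, vs ! j} \<in> E)"
    "n * n + 2 \<le> x \<Longrightarrow> graph_input vs E k x = 0"
proof -
  have loop: "{x} \<notin> E" for x
    using graph unfolding simple_graph_def all_pairs_def by (auto simp: doubleton_eq_iff)
  show "graph_input vs E k 0 = n" "graph_input vs E k 1 = k" "graph_input vs E k 2 = 0"
    using n loop unfolding graph_input_def Let_def by auto
  have "(n + 1) mod n = 1" using mod_add_self1[of n 1] mod_less[of 1 n] n by linarith
  moreover have "(n + 1) div n = 1" using n by (intro div_nat_eqI) auto
  ultimately show "graph_input vs E k (n + 3) = 0"
    using n loop unfolding graph_input_def Let_def by auto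
  show "graph_input vs E k x = 0" if "n * n + 2 \<le> x"
    using that n unfolding graph_input_def Let_def by auto
  assume ij: "i < n" "j < i"
  have "2 + (i * n + j) < n * n + 2" using matrix_address[of i n j] ij by simp
  moreover have "(i * n + j) div n = i" "(i * n + j) mod n = j" using ij by simp_all
  moreover have "0 < i * n" using ij by auto
  ultimately show "graph_input vs E k (2 + (i * n + j)) = of_bool ({vs ! i, vs ! j} \<in> E)"
    using n unfolding graph_input_def Let_def by (auto simp: mult.commute)
qed

text \<open>Both expressions are nonzero at a hit: the first since \<open>valid\<close> demands
  \<open>1 \<le> t\<close>, the second by the added \<open>1\<close>, which \<open>tabulate\<close>
  takes off again.\<close>

definition finder :: com where
  "finder = tabulate 18 (find_first search_vars Valid (Var 0))
    (find_first search_vars Valid (Add_expr (Part 18) (Num 1)))"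

definition finder_cost :: "nat poly" where
  "finder_cost = tabulate_cost (find_first search_vars Valid (Var 0))
    (find_first search_vars Valid (Add_expr (Part 18) (Num 1)))"

lemma finder_correct:
  assumes graph: "simple_graph V E" and vs: "distinct vs" "set vs = V" and n: "2 \<le> card V"
    and w: "range w \<subseteq> V" "valid V (\<lambda>x y. {x, y} \<in> E) k t w"
  shows "runs finder (graph_input vs E k) (poly finder_cost (card V)) (\<lambda>s. \<exists>w'.
    valid V (\<lambda>x y. {x, y} \<in> E) k (s 0) w' \<and>
    (\<forall>j. output_part vs s j = {v \<in> V. part (\<lambda>x y. {x, y} \<in> E) w' v = j}))"
proof -
  let ?a = "\<lambda>x y. {x, y} \<in> E"
  let ?n = "length vs"
  let ?r = "\<lambda>i j. ?a (vs ! i) (vs ! j)"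
  let ?P = "\<lambda>\<rho>. valid {..<?n} ?r k (\<rho> 0) \<rho>"
  have card: "card V = ?n" using vs distinct_card by fastforce
  have fin: "finite V" using graph unfolding simple_graph_def by blast
  \<comment> \<open>Variable \<open>0\<close> also ranges over the vertex numbers, so
    \<open>t\<close> has to be one of them to be found.\<close>
  have "t < ?n"
  proof -
    have "3 * t + 1 \<le> card (conforming V ?a w 1 True)" using w(2) unfolding valid_def by blast
    also have "\<dots> \<le> card V" using fin unfolding conforming_def by (intro card_mono) auto
    finally show ?thesis using card by simp
  qed
  have "\<forall>j. \<exists>i<?n. vs ! i = w j"
    using w(1) unfolding vs(2)[symmetric] by (metis in_set_conv_nth range_subsetD)
  then obtain c where c: "\<And>j. c j < ?n \<and> vs ! c j = w j" by metis
  \<comment> \<open>The search starts in the zero environment, so the witness must be zero at all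
    variables that are not searched.\<close>
  define \<tau>0 where "\<tau>0 j = (if j = 0 then t else if j < 16 then c j else 0)" for j
  have "valid V ?a k t (\<lambda>j. vs ! \<tau>0 j)"
    using w(2) c by (subst valid_cong[of _ w]) (auto simp: \<tau>0_def)
  then have "valid {..<?n} ?r k t \<tau>0"
    using valid_nth[OF vs(1), of ?a k t \<tau>0] unfolding vs(2) by blast
  moreover have "\<tau>0 0 = t" unfolding \<tau>0_def by simp
  ultimately have "?P \<tau>0" by simp
  then have "search ?n ?P search_vars (\<lambda>_. 0) \<noteq> None"
    by (rule search_complete[of ?P \<tau>0]) (use \<open>t < ?n\<close> c in \<open>simp_all add: \<tau>0_def search_vars_def\<close>)
  then obtain \<tau> where \<tau>: "search ?n ?P search_vars (\<lambda>_. 0) = Some \<tau>" by blast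
  have P\<tau>: "?P \<tau>" using search_SomeD(1)[OF \<tau>] .
  have P_upd: "?P (\<rho>(18 := a)) \<longleftrightarrow> ?P \<rho>" for \<rho> a
    using valid_cong[of "\<rho>(18 := a)" \<rho>] by simp
  \<comment> \<open>Whatever vertex number variable \<open>18\<close> holds, the search arrives at
    the same guess.\<close>
  have \<tau>i: "search ?n ?P search_vars ((\<lambda>_. 0)(18 := i)) = Some (\<tau>(18 := i))" for i
    using search_upd[of 18 search_vars ?P, OF _ P_upd] \<tau> by (simp add: search_vars_def)
  have PV: "?P \<rho> \<longleftrightarrow> eval ?n k ?r Valid \<rho> \<noteq> 0" for \<rho>
    using holds_Valid[of ?n k ?r \<rho>] unfolding holds_def by blast
  have P0: "?P \<rho> \<Longrightarrow> eval ?n k ?r (Var 0) \<rho> \<noteq> 0" for \<rho>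
    unfolding valid_def by simp
  have head: "eval ?n k ?r (find_first search_vars Valid (Var 0)) (\<lambda>_. 0) = \<tau> 0"
    by (subst eval_find_first[of ?P, OF P0 PV]) (simp_all add: \<tau>)
  have body: "eval ?n k ?r (find_first search_vars Valid (Add_expr (Part 18) (Num 1))) ((\<lambda>_. 0)(18 := i)) =
      part ?r \<tau> i + 1" for i
    by (subst eval_find_first[of ?P, OF _ PV]) (simp_all add: \<tau>i eval_Part del: fun_upd_apply, simp)
  let ?w = "\<lambda>j. vs ! \<tau> j"
  have part: "part ?r \<tau> i = part ?a ?w (vs ! i)" for i
    unfolding part_def inside_def by simp
  have n2: "2 \<le> ?n" using n card by simp
  note input = graph_input_cells[OF graph refl n2, where k = k]
  have "runs finder (graph_input vs E k) (poly finder_cost ?n) (\<lambda>s. s 0 = \<tau> 0 \<and>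
    (\<forall>i<?n. s (1 + i) = part ?a ?w (vs ! i)))"
    unfolding finder_def finder_cost_def
  proof (rule runs_weaken[OF tabulate_correct[where r = ?r and k = k, OF _ _ n2 input]])
    show "?r i j = ?r j i" for i j by (simp add: insert_commute)
    show "\<not> ?r i i" for i
      using graph unfolding simple_graph_def all_pairs_def by (auto simp: doubleton_eq_iff)
  qed (simp_all add: head body part del: One_nat_def)
  then show ?thesis
    unfolding card
  proof (rule runs_weaken)
    fix s assume s: "s 0 = \<tau> 0 \<and> (\<forall>i<?n. s (1 + i) = part ?a ?w (vs ! i))"
    have "output_part vs s j = {v \<in> V. part ?a ?w v = j}" for j
      unfolding output_part_def vs(2)[symmetric] set_conv_nth using s by auto
    moreover have "valid V ?a k (s 0) ?w"
      using P\<tau> valid_nth[OF vs(1), of ?a k "\<tau> 0" \<tau>] s vs(2) by simp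
    ultimately show "\<exists>w'. valid V ?a k (s 0) w' \<and> (\<forall>j. output_part vs s j = {v \<in> V. part ?a w' v = j})"
      by blast
  qed simp
qed

theorem theorem1:
  shows "\<exists>(prog :: com) (p :: nat poly).
    \<forall>(V :: 'a set) (E :: 'a set set) (k :: nat) (S :: 'a set set) (T :: 'a cotree).
      simple_graph V E \<and> card V > k + 1 \<and>
      \<not> R1_applies V E \<and> \<not> R2_applies V E k \<and> \<not> R3_applies V E \<and>
      is_min_cograph_editing V E S \<and> card S \<le> k \<and>
      is_canonical_cotree T V (sym_diff E S) \<and>
      (\<exists>Q. is_sparse_path 51 T S k Q)
    \<longrightarrow>
      (\<exists>t\<ge>1. \<exists>A B C K I.
         is_nested_t_module V E k t A B C K I \<and> nested_rule_applies E A K I) \<and>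
      (\<forall>vs. distinct vs \<and> set vs = V \<longrightarrow>
         (\<exists>m s. exec prog (graph_input vs E k) m s \<and> m \<le> poly p (card V) \<and>
            s 0 \<ge> 1 \<and>
            is_nested_t_module V E k (s 0)
              (output_part vs s 0) (output_part vs s 1) (output_part vs s 2)
              (output_part vs s 3) (output_part vs s 4) \<and>
            nested_rule_applies E (output_part vs s 0) (output_part vs s 3) (output_part vs s 4)))"
proof (intro exI[of _ finder] exI[of _ finder_cost] allI impI, elim conjE exE, intro conjI allI impI)
  fix V :: "'a set" and E S :: "'a set set" and k T Q
  assume graph: "simple_graph V E" and "k + 1 < card V" and "is_min_cograph_editing V E S"
    and "is_canonical_cotree T V (sym_diff E S)" "is_sparse_path 51 T S k Q"
  then obtain D t m L join where "levels V E S D k t m L join"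
    using sparse_path_levels[OF graph]
    unfolding is_min_cograph_editing_def is_cograph_editing_def by metis
  then interpret levels V E S D k t m L join .
  obtain w where w: "range w \<subseteq> V" "valid V adj k t w"
    using valid_windows by blast
  show "\<exists>t\<ge>1. \<exists>A B C K I. is_nested_t_module V E k t A B C K I \<and> nested_rule_applies E A K I"
    using valid_nested[OF graph w(2)] t_pos by blast
  fix vs assume "distinct vs \<and> set vs = V"
  then obtain m' s w' where "exec finder (graph_input vs E k) m' s" "m' \<le> poly finder_cost (card V)"
    and w': "valid V adj k (s 0) w'" "\<And>j. output_part vs s j = {v \<in> V. part adj w' v = j}"
    using finder_correct[OF graph _ _ _ w, of vs] \<open>k + 1 < card V\<close> unfolding runs_def by auto
  moreover have "s 0 \<ge> 1" using w'(1) unfolding valid_def by blast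
  ultimately show "\<exists>m s. exec finder (graph_input vs E k) m s \<and> m \<le> poly finder_cost (card V) \<and>
      s 0 \<ge> 1 \<and>
      is_nested_t_module V E k (s 0)
        (output_part vs s 0) (output_part vs s 1) (output_part vs s 2)
        (output_part vs s 3) (output_part vs s 4) \<and>
      nested_rule_applies E (output_part vs s 0) (output_part vs s 3) (output_part vs s 4)"
    using valid_nested[OF graph w'(1)] by (intro exI[of _ m'] exI[of _ s]) (simp add: w'(2))
qed

end
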